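(* Let $N=2$, $d=2m$, and let $\mathcal{A}=A^{(1)}\frac{\partial}{\partial x_1}+A^{(2)}\frac{\partial}{\partial x_2}$, with $A^{(1)},A^{(2)}\in\mathbb{R}^{m\times d}$, satisfy $\mathrm{rank}\left(A^{(1)}w_1+A^{(2)}w_2\right)=m$ for every $w\in\mathbb{R}^2\setminus\{0\}$. Suppose that $\ker A^{(1)}\cap\ker A^{(2)}=\{0\}$. Let $\Omega\subset\mathbb{R}^2$ be a bounded open set. Let $F:\mathbb{R}^d\to\mathbb{R}$ be continuous, $\mathcal{A}$-quasiconvex and coercive, i.e. $\lim_{|\xi|\to+\infty}F(\xi)=+\infty$, and set $$E=\{\xi\in\mathbb{R}^d: F(\xi)=0\}.$$ Assume $\mathrm{int}\,\Lambda\mathrm{co}E\ne\emptyset$ and let $\xi\in E\cup\mathrm{int}\,\Lambda\mathrm{co}E$. Then there exists $u\in L^\infty(\mathbb{R}^2;\mathbb{R}^d)$ such that $u(x)\in E$ for a.e. $x\in\Omega$, $\mathcal{A}u=0$ in $\mathcal{D}'(\mathbb{R}^2;\mathbb{R}^m)$, and $u=\xi$ on $\mathbb{R}^2\setminus\Omega$.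
   Context: $\mathcal{A}$-quasiconvexity: a Borel measurable function $F:\mathbb{R}^d\to\mathbb{R}$ is $\mathcal{A}$-quasiconvex if $F(\xi)\le\int_Q F(\xi+w(x))\,dx$ for every $\xi\in\mathbb{R}^d$ and every $Q$-periodic $w\in C^\infty(\mathbb{R}^2;\mathbb{R}^d)$ with $\mathcal{A}w=0$ in $\mathbb{R}^2$ and $\int_Q w\,dx=0$, where $Q=(0,1)^2$. The characteristic cone of $\mathcal{A}$ is $\Lambda=\{v\in\mathbb{R}^d:\exists w\in\mathbb{R}^2\setminus\{0\},\ (A^{(1)}w_1+A^{(2)}w_2)v=0\}$. A function $G:\mathbb{R}^d\to\mathbb{R}\cup\{+\infty\}$ is $\Lambda$-convex if it is convex along the directions of $\Lambda$, i.e. $G(ta+(1-t)b)\le tG(a)+(1-t)G(b)$ for all $t\in[0,1]$ and all $a,b\in\mathbb{R}^d$ with $b-a\in\Lambda$. For $E\subset\mathbb{R}^d$, $$\Lambda\mathrm{co}E=\{\xi\in\mathbb{R}^d: G(\xi)\le0\text{ for every }\Lambda\text{-convex } G:\mathbb{R}^d\to\mathbb{R}\cup\{+\infty\}\text{ with }G=0\text{ on }E\}.$$ $\mathrm{int}$ denotes the interior. *)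

theory Defs
  imports "HOL-Analysis.Analysis"
begin

definition partial_deriv :: "'n \<Rightarrow> (real ^ 'n \<Rightarrow> 'b) \<Rightarrow> real ^ 'n \<Rightarrow> 'b::real_normed_vector"
  where "partial_deriv i f x = frechet_derivative f (at x) (axis i 1)"

text \<open>Functions of class \<open>C\<^sup>k\<close> and \<open>C\<^sup>\<infinity>\<close> on the whole space.\<close>

primrec Ck :: "nat \<Rightarrow> (real ^ 'n \<Rightarrow> 'b::real_normed_vector) \<Rightarrow> bool"
  where
    "Ck 0 f \<longleftrightarrow> continuous_on UNIV f"
  | "Ck (Suc k) f \<longleftrightarrow> f differentiable_on UNIV \<and> (\<forall>i. Ck k (partial_deriv i f))"

definition C_infinity :: "(real ^ 'n \<Rightarrow> 'b::real_normed_vector) \<Rightarrow> bool"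
  where "C_infinity f \<longleftrightarrow> (\<forall>k. Ck k f)"

definition test_function :: "(real ^ 'n \<Rightarrow> real) \<Rightarrow> bool"
  where "test_function \<phi> \<longleftrightarrow> C_infinity \<phi> \<and> compact (closure {x. \<phi> x \<noteq> 0})"

definition L_infinity :: "(real ^ 'n \<Rightarrow> real ^ 'd) \<Rightarrow> bool"
  where "L_infinity u \<longleftrightarrow>
    u \<in> borel_measurable lebesgue \<and> (\<exists>C. AE x in lebesgue. norm (u x) \<le> C)"

definition unit_square :: "(real ^ 2) set"
  where "unit_square = {x. \<forall>i. 0 < x $ i \<and> x $ i < 1}"

definition Q_periodic :: "(real ^ 2 \<Rightarrow> 'b) \<Rightarrow> bool"
  where "Q_periodic w \<longleftrightarrow> (\<forall>x i. w (x + axis i 1) = w x)"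

definition diff_op ::
    "real ^ 'd ^ 'm \<Rightarrow> real ^ 'd ^ 'm \<Rightarrow> (real ^ 2 \<Rightarrow> real ^ 'd) \<Rightarrow> real ^ 2 \<Rightarrow> real ^ 'm"
  where "diff_op A1 A2 w x = A1 *v partial_deriv 1 w x + A2 *v partial_deriv 2 w x"

text \<open>
  The distribution \<open>\<A>u\<close>, for locally integrable \<open>u\<close>, evaluated at a scalar test function; this is
  the vector of the pairings of the components of \<open>\<A>u\<close> with \<open>\<phi>\<close>. The integrand is integrable
  whenever \<open>u\<close> is in \<open>L\<^sup>\<infinity>\<close>.
\<close>

definition distr_diff_op ::
    "real ^ 'd ^ 'm \<Rightarrow> real ^ 'd ^ 'm \<Rightarrow> (real ^ 2 \<Rightarrow> real ^ 'd) \<Rightarrow> (real ^ 2 \<Rightarrow> real) \<Rightarrow> real ^ 'm"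
  where "distr_diff_op A1 A2 u \<phi> =
    - (LINT x|lebesgue. partial_deriv 1 \<phi> x *\<^sub>R (A1 *v u x) + partial_deriv 2 \<phi> x *\<^sub>R (A2 *v u x))"

definition diff_op_free ::
    "real ^ 'd ^ 'm \<Rightarrow> real ^ 'd ^ 'm \<Rightarrow> (real ^ 2 \<Rightarrow> real ^ 'd) \<Rightarrow> bool"
  where "diff_op_free A1 A2 u \<longleftrightarrow> (\<forall>\<phi>. test_function \<phi> \<longrightarrow> distr_diff_op A1 A2 u \<phi> = 0)"

definition principal_symbol ::
    "real ^ 'd ^ 'm \<Rightarrow> real ^ 'd ^ 'm \<Rightarrow> real ^ 2 \<Rightarrow> real ^ 'd ^ 'm"
  where "principal_symbol A1 A2 w = (w $ 1) *\<^sub>R A1 + (w $ 2) *\<^sub>R A2"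

text \<open>
  For continuous \<open>F\<close> the integrand below is bounded on the unit square, so the integral is a genuine
  one; for a merely Borel \<open>F\<close> it may take the default value \<open>0\<close> of the Bochner integral.
\<close>

definition A_quasiconvex ::
    "real ^ 'd ^ 'm \<Rightarrow> real ^ 'd ^ 'm \<Rightarrow> (real ^ 'd \<Rightarrow> real) \<Rightarrow> bool"
  where "A_quasiconvex A1 A2 F \<longleftrightarrow>
    F \<in> borel_measurable borel \<and>
    (\<forall>\<xi> w. C_infinity w \<and> Q_periodic w \<and> (\<forall>x. diff_op A1 A2 w x = 0) \<and>
        (LINT x:unit_square|lebesgue. w x) = 0 \<longrightarrow>
      F \<xi> \<le> (LINT x:unit_square|lebesgue. F (\<xi> + w x)))"

definition characteristic_cone :: "real ^ 'd ^ 'm \<Rightarrow> real ^ 'd ^ 'm \<Rightarrow> (real ^ 'd) set"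
  where "characteristic_cone A1 A2 = {v. \<exists>w. w \<noteq> 0 \<and> principal_symbol A1 A2 w *v v = 0}"

text \<open>
  Functions into \<open>\<real> \<union> {+\<infinity>}\<close> are \<^typ>\<open>ereal\<close>-valued functions avoiding \<open>-\<infinity>\<close>. The endpoint cases
  \<open>t = 0\<close> and \<open>t = 1\<close> hold trivially, since \<open>0 * \<infinity> = 0\<close> in \<^typ>\<open>ereal\<close>.
\<close>

definition Lambda_convex :: "(real ^ 'd) set \<Rightarrow> (real ^ 'd \<Rightarrow> ereal) \<Rightarrow> bool"
  where "Lambda_convex \<Lambda> G \<longleftrightarrow>
    (\<forall>x. G x \<noteq> -\<infinity>) \<and>
    (\<forall>t a b. 0 \<le> t \<and> t \<le> 1 \<and> b - a \<in> \<Lambda> \<longrightarrow>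
      G (t *\<^sub>R a + (1 - t) *\<^sub>R b) \<le> ereal t * G a + ereal (1 - t) * G b)"

definition Lambda_co :: "(real ^ 'd) set \<Rightarrow> (real ^ 'd) set \<Rightarrow> (real ^ 'd) set"
  where "Lambda_co \<Lambda> E = {\<xi>. \<forall>G. Lambda_convex \<Lambda> G \<and> (\<forall>\<eta>\<in>E. G \<eta> = 0) \<longrightarrow> G \<xi> \<le> 0}"

end

theory Submission
  imports Defs
begin

text \<open>
  Since \<open>v \<mapsto> (A\<^sup>1 v, A\<^sup>2 v)\<close> is an isomorphism of \<open>\<real>\<^sup>2\<^sup>m\<close> with inverse \<open>T\<close>, for a fixed nonzero \<open>a\<close>
  every field \<open>T (- \<partial>\<^sub>2 f a, \<partial>\<^sub>1 f a)\<close> with Lipschitz scalar \<open>f\<close> is \<open>\<A>\<close>-free. Quasiconvexity makes \<open>F\<close>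
  convex along \<open>\<Lambda>\<close>, so \<open>F \<xi> \<le> 0\<close>. If \<open>F \<xi> = 0\<close> the constant \<open>\<xi>\<close> is a solution. Otherwise, by coercivity,
  \<open>F\<close> vanishes at some point of each of the four rays from \<open>\<xi>\<close> in the directions \<open>\<plusminus> T (0, a)\<close> and
  \<open>\<plusminus> T (- a, 0)\<close>. On any rectangle a roof-shaped \<open>f\<close>, vanishing on the boundary, has a gradient that
  takes only the four corresponding values; filling \<open>\<Omega>\<close> with countably many rectangles gives the solution.
\<close>

section \<open>Difference quotients and weak derivatives\<close>

text \<open>For a fixed \<open>a\<close> the vectors \<open>T (- p2 a, p1 a)\<close>, with p in the
  plane, form a linear family inside the characteristic cone: the symbol at p annihilates the member
  belonging to p. On this family the differential constraint becomes a scalar curl condition on p,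
  and one value on each of the four half-axes is enough for an exact solution, so no limit of
  approximate solutions is taken. Two obstacles shape the rest. The potentials have kinks, so the
  curl condition is derived from difference quotients, and the rectangles are joined as curl-free
  fields rather than as potentials. Moreover, quasiconvexity speaks only of smooth fields periodic
  on the unit square, that is, of integer frequencies. A cone direction belonging to another
  frequency has to be approximated by directions belonging to rational ones, and this needs kernel
  vectors of the symbol that depend continuously on the frequency; the inverse \<open>T\<close>
  supplies them.\<close>

definition step :: "'n \<Rightarrow> nat \<Rightarrow> real ^ 'n"
  where "step i n = axis i (inverse (real (Suc n)))"

definition fwd_quot :: "'n \<Rightarrow> nat \<Rightarrow> (real ^ 'n \<Rightarrow> real) \<Rightarrow> real ^ 'n \<Rightarrow> real"
  where "fwd_quot i n f x = real (Suc n) * (f (x + step i n) - f x)"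

text \<open>The sign makes this the adjoint of \<open>fwd_quot\<close>; in return it tends to minus
  the partial derivative.\<close>

definition bwd_quot :: "'n \<Rightarrow> nat \<Rightarrow> (real ^ 'n \<Rightarrow> real) \<Rightarrow> real ^ 'n \<Rightarrow> real"
  where "bwd_quot i n f x = real (Suc n) * (f (x - step i n) - f x)"

text \<open>A class that contains the test functions and is closed under \<open>bwd_quot\<close>,
  with only first derivatives to follow.\<close>

definition C1_compact :: "(real ^ 'n \<Rightarrow> real) \<Rightarrow> bool"
  where "C1_compact \<phi> \<longleftrightarrow> \<phi> differentiable_on UNIV \<and>
    (\<forall>i. continuous_on UNIV (partial_deriv i \<phi>)) \<and> (\<exists>R. \<forall>x. R < norm x \<longrightarrow> \<phi> x = 0)"

lemma step_eq: "step i n = inverse (real (Suc n)) *\<^sub>R axis i 1"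
  by (simp add: step_def axis_def vec_eq_iff)

lemma norm_step: "norm (step i n) = inverse (real (Suc n))"
  by (simp add: step_eq)

lemma norm_step_le_1: "norm (step i n) \<le> 1"
  by (simp add: norm_step field_simps)

lemma step_tendsto_0: "step i \<longlonglongrightarrow> 0"
  by (rule tendsto_norm_zero_cancel) (simp only: norm_step LIMSEQ_inverse_real_of_nat)

lemma has_real_derivative_partial:
  fixes \<phi> :: "real ^ 'n \<Rightarrow> real"
  assumes "\<phi> differentiable_on UNIV"
  shows "((\<lambda>t. \<phi> (x + t *\<^sub>R axis i 1)) has_real_derivative partial_deriv i \<phi> (x + t *\<^sub>R axis i 1)) (at t)"
proof -
  let ?y = "x + t *\<^sub>R axis i 1"
  have "(\<phi> has_derivative frechet_derivative \<phi> (at ?y)) (at ?y)"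
    using assms by (simp add: differentiable_on_def frechet_derivative_works)
  moreover have "((\<lambda>t. x + t *\<^sub>R axis i 1) has_derivative (\<lambda>s. s *\<^sub>R axis i 1)) (at t)"
    by (auto intro!: derivative_eq_intros)
  ultimately have "((\<lambda>t. \<phi> (x + t *\<^sub>R axis i 1)) has_derivative
      (\<lambda>s. frechet_derivative \<phi> (at ?y) (s *\<^sub>R axis i 1))) (at t)"
    using has_derivative_compose by blast
  moreover have "linear (frechet_derivative \<phi> (at ?y))"
    using assms by (simp add: differentiable_on_def linear_frechet_derivative)
  ultimately show ?thesis
    unfolding has_field_derivative_def partial_deriv_def
    by (simp add: linear_cmul mult_commute_abs)
qed

lemma partial_deriv_zero_outside:
  fixes \<phi> :: "real ^ 'n \<Rightarrow> real"
  assumes "\<And>x. R < norm x \<Longrightarrow> \<phi> x = 0" "R < norm x"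
  shows "partial_deriv i \<phi> x = 0"
proof -
  have "open {x :: real ^ 'n. R < norm x}"
    by (intro open_Collect_less continuous_intros)
  then have "(\<phi> has_derivative (\<lambda>_. 0)) (at x)"
    by (rule has_derivative_transform_within_open[OF has_derivative_const]) (simp_all add: assms)
  then show ?thesis
    unfolding partial_deriv_def by (simp add: frechet_derivative_at[symmetric])
qed

lemma partial_deriv_shift:
  fixes \<phi> :: "real ^ 'n \<Rightarrow> real"
  assumes "\<phi> differentiable_on UNIV"
  shows "(\<lambda>x. \<phi> (x + h)) differentiable_on UNIV"
    and "partial_deriv i (\<lambda>x. \<phi> (x + h)) x = partial_deriv i \<phi> (x + h)"
proof -
  have *: "((\<lambda>x. \<phi> (x + h)) has_derivative frechet_derivative \<phi> (at (x + h))) (at x)" for x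
  proof -
    have "(\<phi> has_derivative frechet_derivative \<phi> (at (x + h))) (at (x + h))"
      using assms by (simp add: differentiable_on_def frechet_derivative_works)
    moreover have "((\<lambda>x. x + h) has_derivative (\<lambda>s. s)) (at x)"
      by (auto intro!: derivative_eq_intros)
    ultimately show ?thesis using has_derivative_compose by blast
  qed
  then show "(\<lambda>x. \<phi> (x + h)) differentiable_on UNIV"
    by (auto simp: differentiable_on_def differentiable_def)
  show "partial_deriv i (\<lambda>x. \<phi> (x + h)) x = partial_deriv i \<phi> (x + h)"
    unfolding partial_deriv_def by (simp add: frechet_derivative_at[OF *, symmetric])
qed

lemma bounded_support_bwd_quot:
  assumes "\<And>x. R < norm x \<Longrightarrow> f x = 0" "R + 1 < norm x"
  shows "bwd_quot i n f x = 0"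
proof -
  have "norm x - norm (step i n) \<le> norm (x - step i n)"
    by (rule norm_triangle_ineq2)
  then have "R < norm (x - step i n)" "R < norm x"
    using assms(2) norm_step_le_1[of i n] by linarith+
  then show ?thesis using assms(1) by (simp add: bwd_quot_def)
qed

lemma bounded_if_continuous_compact_support:
  fixes \<psi> :: "real ^ 'n \<Rightarrow> real"
  assumes "continuous_on UNIV \<psi>" "\<And>x. R < norm x \<Longrightarrow> \<psi> x = 0"
  obtains B where "0 \<le> B" "\<And>x. \<bar>\<psi> x\<bar> \<le> B"
proof -
  have "compact (\<psi> ` cball 0 R)"
    using assms(1) by (intro compact_continuous_image) (auto intro: continuous_on_subset)
  then obtain B where B: "\<And>x. x \<in> cball 0 R \<Longrightarrow> \<bar>\<psi> x\<bar> \<le> B"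
    by (force dest!: compact_imp_bounded simp: bounded_iff)
  have "\<bar>\<psi> x\<bar> \<le> max B 0" for x
    using B[of x] assms(2)[of x] by (cases "norm x \<le> R") auto
  then show ?thesis using that[of "max B 0"] by simp
qed

lemma integrable_if_bounded_support:
  fixes \<psi> :: "real ^ 'n \<Rightarrow> real"
  assumes "\<psi> \<in> borel_measurable borel" "\<And>x. R < norm x \<Longrightarrow> \<psi> x = 0" "\<And>x. \<bar>\<psi> x\<bar> \<le> B"
  shows "integrable lborel \<psi>"
proof (rule Bochner_Integration.integrable_bound)
  show "integrable lborel (\<lambda>x::real^'n. B * indicator (cball 0 R) x :: real)"
    using emeasure_lborel_cball_finite[of "0::real^'n" R]
    by (intro integrable_mult_right integrable_real_indicator) auto
  show "AE x in lborel. norm (\<psi> x) \<le> norm (B * indicator (cball 0 R) x :: real)"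
  proof (rule AE_I2)
    fix x :: "real ^ 'n"
    show "norm (\<psi> x) \<le> norm (B * indicator (cball 0 R) x :: real)"
      using assms(2)[of x] assms(3)[of x] by (cases "norm x \<le> R") (auto simp: indicator_def)
  qed
qed (use assms in simp)

lemma integral_shift:
  fixes f \<psi> :: "real ^ 'n \<Rightarrow> real"
  assumes [measurable]: "\<psi> \<in> borel_measurable borel" "f \<in> borel_measurable borel"
  shows "(LINT x|lborel. \<psi> x * f (x + h)) = (LINT x|lborel. \<psi> (x - h) * f x)"
proof -
  have "(LINT x|lborel. \<psi> (x - h) * f x) = (LINT x|distr lborel borel ((+) h). \<psi> (x - h) * f x)"
    by (simp add: lborel_distr_plus)
  also have "\<dots> = (LINT x|lborel. \<psi> x * f (x + h))"
    by (subst integral_distr) (simp_all add: add.commute)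
  finally show ?thesis by simp
qed

text \<open>Discrete integration by parts: translation invariance moves the shift to \<psi>, whose
  support grows by at most 1.\<close>

lemma integral_fwd_quot:
  fixes f \<psi> :: "real ^ 'n \<Rightarrow> real"
  assumes \<psi>: "continuous_on UNIV \<psi>" "\<And>x. R < norm x \<Longrightarrow> \<psi> x = 0"
    and f[measurable]: "f \<in> borel_measurable borel" and fb: "\<And>x. \<bar>f x\<bar> \<le> C"
  shows "(LINT x|lborel. \<psi> x * fwd_quot i n f x) = (LINT x|lborel. bwd_quot i n \<psi> x * f x)"
proof -
  let ?h = "step i n"
  have [measurable]: "\<psi> \<in> borel_measurable borel"
    using \<psi>(1) by (simp add: borel_measurable_continuous_onI)
  obtain B where B: "0 \<le> B" "\<And>x. \<bar>\<psi> x\<bar> \<le> B"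
    using bounded_if_continuous_compact_support[OF \<psi>] by blast
  have 1: "integrable lborel (\<lambda>x. \<psi> x * f (x + k))" for k
    by (rule integrable_if_bounded_support[where R = R and B = "B * C"])
       (use \<psi> B fb in \<open>auto simp: abs_mult intro!: mult_mono\<close>)
  have 2: "integrable lborel (\<lambda>x. \<psi> (x - ?h) * f x)"
  proof (rule integrable_if_bounded_support[where R = "R + 1" and B = "B * C"])
    fix x :: "real ^ 'n"
    have "norm x - norm ?h \<le> norm (x - ?h)"
      by (rule norm_triangle_ineq2)
    then show "R + 1 < norm x \<Longrightarrow> \<psi> (x - ?h) * f x = 0"
      using \<psi>(2)[of "x - ?h"] norm_step_le_1[of i n] by simp
    show "\<bar>\<psi> (x - ?h) * f x\<bar> \<le> B * C"
      using B fb by (auto simp: abs_mult intro!: mult_mono)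
  qed simp
  have "(LINT x|lborel. \<psi> x * fwd_quot i n f x)
      = real (Suc n) * (LINT x|lborel. \<psi> x * f (x + ?h) - \<psi> x * f x)"
    by (subst integral_mult_right_zero[symmetric])
       (simp add: fwd_quot_def right_diff_distrib algebra_simps)
  also have "\<dots> = real (Suc n) * ((LINT x|lborel. \<psi> (x - ?h) * f x) - (LINT x|lborel. \<psi> x * f x))"
    using 1[of ?h] 1[of 0] by (simp add: integral_shift)
  also have "\<dots> = real (Suc n) * (LINT x|lborel. \<psi> (x - ?h) * f x - \<psi> x * f x)"
    using 2 1[of 0] by simp
  also have "\<dots> = (LINT x|lborel. bwd_quot i n \<psi> x * f x)"
    by (subst integral_mult_right_zero[symmetric])
       (simp add: bwd_quot_def algebra_simps)
  finally show ?thesis .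
qed

text \<open>The Lipschitz constant bounds all quotients at once, so dominated convergence
  applies.\<close>

lemma integral_fwd_quot_tendsto:
  fixes f g \<psi> :: "real ^ 'n \<Rightarrow> real"
  assumes \<psi>: "continuous_on UNIV \<psi>" "\<And>x. R < norm x \<Longrightarrow> \<psi> x = 0"
    and f: "L-lipschitz_on UNIV f" and [measurable]: "g \<in> borel_measurable borel"
    and g: "AE x in lborel. (\<lambda>n. fwd_quot i n f x) \<longlonglongrightarrow> g x"
  shows "(\<lambda>n. LINT x|lborel. \<psi> x * fwd_quot i n f x) \<longlonglongrightarrow> (LINT x|lborel. \<psi> x * g x)"
proof (rule integral_dominated_convergence[where w = "\<lambda>x. \<bar>\<psi> x\<bar> * L"])
  have [measurable]: "\<psi> \<in> borel_measurable borel"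
    using \<psi>(1) by (simp add: borel_measurable_continuous_onI)
  have [measurable]: "f \<in> borel_measurable borel"
    using lipschitz_on_continuous_on[OF f] by (simp add: borel_measurable_continuous_onI)
  show "(\<lambda>x. \<psi> x * g x) \<in> borel_measurable lborel"
    and "(\<lambda>x. \<psi> x * fwd_quot i n f x) \<in> borel_measurable lborel" for n
    unfolding fwd_quot_def by measurable
  obtain B where B: "0 \<le> B" "\<And>x. \<bar>\<psi> x\<bar> \<le> B"
    using bounded_if_continuous_compact_support[OF \<psi>] by blast
  then have "integrable lborel \<psi>"
    by (intro integrable_if_bounded_support[where R = R and B = B]) (use \<psi> in auto)
  then show "integrable lborel (\<lambda>x. \<bar>\<psi> x\<bar> * L)"
    by auto
  show "AE x in lborel. (\<lambda>n. \<psi> x * fwd_quot i n f x) \<longlonglongrightarrow> \<psi> x * g x"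
    using g by eventually_elim (intro tendsto_intros)
  have "\<bar>fwd_quot i n f x\<bar> \<le> L" for n x
  proof -
    have "\<bar>f (x + step i n) - f x\<bar> \<le> L * inverse (real (Suc n))"
      using lipschitz_onD[OF f, of "x + step i n" x] by (simp add: dist_norm norm_step)
    then show ?thesis
      unfolding fwd_quot_def abs_mult by (simp add: field_simps)
  qed
  then show "AE x in lborel. norm (\<psi> x * fwd_quot i n f x) \<le> \<bar>\<psi> x\<bar> * L" for n
    by (auto simp: abs_mult intro!: mult_left_mono)
qed

lemma C1_compact_partialE:
  assumes "C1_compact \<phi>"
  obtains R where "\<phi> differentiable_on UNIV" "continuous_on UNIV \<phi>"
    "\<And>i. continuous_on UNIV (partial_deriv i \<phi>)"
    "\<And>x. R < norm x \<Longrightarrow> \<phi> x = 0" "\<And>i x. R < norm x \<Longrightarrow> partial_deriv i \<phi> x = 0"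
proof -
  obtain R where "\<And>x. R < norm x \<Longrightarrow> \<phi> x = 0"
    using assms unfolding C1_compact_def by blast
  moreover from this have "\<And>i x. R < norm x \<Longrightarrow> partial_deriv i \<phi> x = 0"
    by (rule partial_deriv_zero_outside)
  ultimately show ?thesis
    using that assms unfolding C1_compact_def by (metis differentiable_imp_continuous_on)
qed

text \<open>The derivative falls on the smooth factor. Asking only boundedness and measurability of
  \<open>f\<close> allows a discontinuous gradient component to take its place later.\<close>

lemma integral_bwd_quot_tendsto:
  fixes f \<phi> :: "real ^ 'n \<Rightarrow> real"
  assumes \<phi>: "C1_compact \<phi>"
    and f[measurable]: "f \<in> borel_measurable borel" and fb: "\<And>x. \<bar>f x\<bar> \<le> C"
  shows "(\<lambda>n. LINT x|lborel. bwd_quot i n \<phi> x * f x) \<longlonglongrightarrow> - (LINT x|lborel. partial_deriv i \<phi> x * f x)"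
proof -
  obtain R where R: "\<phi> differentiable_on UNIV" "continuous_on UNIV \<phi>"
    "\<And>i. continuous_on UNIV (partial_deriv i \<phi>)"
    "\<And>x. R < norm x \<Longrightarrow> \<phi> x = 0" "\<And>i x. R < norm x \<Longrightarrow> partial_deriv i \<phi> x = 0"
    using C1_compact_partialE[OF \<phi>] by blast
  have [measurable]: "\<phi> \<in> borel_measurable borel" "partial_deriv i \<phi> \<in> borel_measurable borel"
    using R(2,3) by (simp_all add: borel_measurable_continuous_onI)
  obtain B where B: "0 \<le> B" "\<And>x. \<bar>partial_deriv i \<phi> x\<bar> \<le> B"
    using bounded_if_continuous_compact_support[OF R(3,5)] by blast
  have der: "((\<lambda>t. \<phi> (x + t *\<^sub>R axis i 1)) has_real_derivative
      partial_deriv i \<phi> (x + t *\<^sub>R axis i 1)) (at t within S)" for x t S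
    using has_real_derivative_partial[OF R(1), where t = t]
    by (auto intro: has_field_derivative_at_within)
  have lim: "(\<lambda>n. bwd_quot i n \<phi> x) \<longlonglongrightarrow> - partial_deriv i \<phi> x" for x
  proof -
    have "((\<lambda>t. (\<phi> (x + t *\<^sub>R axis i 1) - \<phi> x) / t) \<longlongrightarrow> partial_deriv i \<phi> x) (at 0)"
      using der[of x 0 UNIV] unfolding has_field_derivative_iff by simp
    moreover have "filterlim (\<lambda>n. - inverse (real (Suc n))) (at 0) sequentially"
      unfolding filterlim_at using LIMSEQ_inverse_real_of_nat by (auto dest: tendsto_minus)
    ultimately have "(\<lambda>n. (\<phi> (x + (- inverse (real (Suc n))) *\<^sub>R axis i 1) - \<phi> x) / (- inverse (real (Suc n))))
        \<longlonglongrightarrow> partial_deriv i \<phi> x"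
      by (rule filterlim_compose)
    then have "(\<lambda>n. - ((\<phi> (x + (- inverse (real (Suc n))) *\<^sub>R axis i 1) - \<phi> x) / (- inverse (real (Suc n)))))
        \<longlonglongrightarrow> - partial_deriv i \<phi> x"
      by (rule tendsto_minus)
    then show ?thesis
      by (simp add: bwd_quot_def step_eq field_simps del: of_nat_Suc)
  qed
  \<comment> \<open>The mean value inequality along the coordinate line gives a bound independent of
    n.\<close>
  have bound: "\<bar>bwd_quot i n \<phi> x\<bar> \<le> B" for n x
  proof -
    have "norm (\<phi> (x + (- inverse (real (Suc n))) *\<^sub>R axis i 1) - \<phi> (x + 0 *\<^sub>R axis i 1))
        \<le> B * norm (- inverse (real (Suc n)) - 0)"
      using B(2) der[of x _ UNIV]
      by (intro field_differentiable_bound[where S = UNIV and f = "\<lambda>t. \<phi> (x + t *\<^sub>R axis i 1)"]) auto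
    then have "\<bar>\<phi> (x - step i n) - \<phi> x\<bar> \<le> B * inverse (real (Suc n))"
      by (simp add: step_eq del: of_nat_Suc)
    then show ?thesis
      unfolding bwd_quot_def abs_mult by (simp add: field_simps)
  qed
  have "(\<lambda>n. LINT x|lborel. bwd_quot i n \<phi> x * f x) \<longlonglongrightarrow> (LINT x|lborel. - partial_deriv i \<phi> x * f x)"
  proof (rule integral_dominated_convergence[where w = "\<lambda>x. B * C * indicator (cball 0 (R + 1)) x"])
    show "(\<lambda>x. - partial_deriv i \<phi> x * f x) \<in> borel_measurable lborel"
      and "(\<lambda>x. bwd_quot i n \<phi> x * f x) \<in> borel_measurable lborel" for n
      unfolding bwd_quot_def by measurable
    show "integrable lborel (\<lambda>x::real^'n. B * C * indicator (cball 0 (R + 1)) x :: real)"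
      using emeasure_lborel_cball_finite[of "0::real^'n" "R + 1"]
      by (intro integrable_mult_right integrable_real_indicator) auto
    show "AE x in lborel. (\<lambda>n. bwd_quot i n \<phi> x * f x) \<longlonglongrightarrow> - partial_deriv i \<phi> x * f x"
      by (intro AE_I2 tendsto_mult lim tendsto_const)
    have "norm (bwd_quot i n \<phi> x * f x) \<le> B * C * indicator (cball 0 (R + 1)) x" for n x
    proof (cases "norm x \<le> R + 1")
      case True
      then show ?thesis
        using bound[of n x] fb[of x] B(1) by (auto simp: abs_mult intro!: mult_mono)
    next
      case False
      then show ?thesis
        using bounded_support_bwd_quot[of R \<phi> x i n] R(4) by simp
    qed
    then show "AE x in lborel. norm (bwd_quot i n \<phi> x * f x) \<le> B * C * indicator (cball 0 (R + 1)) x" for n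
      by simp
  qed
  then show ?thesis by simp
qed

text \<open>One sequence of integrals has two limits, according to which factor carries the
  difference quotient.\<close>

lemma integral_by_parts:
  fixes f g \<phi> :: "real ^ 'n \<Rightarrow> real"
  assumes \<phi>: "C1_compact \<phi>"
    and f: "L-lipschitz_on UNIV f" "\<And>x. \<bar>f x\<bar> \<le> C" and g: "g \<in> borel_measurable borel"
      "AE x in lborel. (\<lambda>n. fwd_quot i n f x) \<longlonglongrightarrow> g x"
  shows "(LINT x|lborel. \<phi> x * g x) = - (LINT x|lborel. partial_deriv i \<phi> x * f x)"
proof -
  obtain R where R: "continuous_on UNIV \<phi>" "\<And>x. R < norm x \<Longrightarrow> \<phi> x = 0"
    using C1_compact_partialE[OF \<phi>] by metis
  have fm: "f \<in> borel_measurable borel"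
    using lipschitz_on_continuous_on[OF f(1)] by (simp add: borel_measurable_continuous_onI)
  have "(\<lambda>n. LINT x|lborel. bwd_quot i n \<phi> x * f x) \<longlonglongrightarrow> (LINT x|lborel. \<phi> x * g x)"
    using integral_fwd_quot_tendsto[OF R f(1) g] integral_fwd_quot[OF R fm f(2)] by simp
  moreover have "(\<lambda>n. LINT x|lborel. bwd_quot i n \<phi> x * f x) \<longlonglongrightarrow> - (LINT x|lborel. partial_deriv i \<phi> x * f x)"
    by (rule integral_bwd_quot_tendsto[OF \<phi> fm f(2)])
  ultimately show ?thesis by (rule LIMSEQ_unique)
qed

text \<open>Integration by parts against the constant function 1.\<close>

lemma integral_partial_deriv_eq_0:
  fixes \<phi> :: "real ^ 'n \<Rightarrow> real"
  assumes "C1_compact \<phi>"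
  shows "(LINT x|lborel. partial_deriv i \<phi> x) = 0"
  using integral_by_parts[OF assms, of 0 "\<lambda>_. 1" 1 "\<lambda>_. 0" i]
  by (simp add: lipschitz_on_def fwd_quot_def)

lemma C1_compact_bwd_quot:
  fixes \<phi> :: "real ^ 'n \<Rightarrow> real"
  assumes "C1_compact \<phi>"
  shows "C1_compact (bwd_quot i n \<phi>)"
    and "partial_deriv j (bwd_quot i n \<phi>) = bwd_quot i n (partial_deriv j \<phi>)"
proof -
  obtain R where R: "\<phi> differentiable_on UNIV" "continuous_on UNIV \<phi>"
    "\<And>i. continuous_on UNIV (partial_deriv i \<phi>)"
    "\<And>x. R < norm x \<Longrightarrow> \<phi> x = 0" "\<And>i x. R < norm x \<Longrightarrow> partial_deriv i \<phi> x = 0"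
    using C1_compact_partialE[OF assms] by blast
  let ?s = "\<lambda>x. \<phi> (x + (- step i n))"
  have s: "?s differentiable_on UNIV" "\<And>j x. partial_deriv j ?s x = partial_deriv j \<phi> (x - step i n)"
    using partial_deriv_shift[OF R(1), where h = "- step i n"] by simp_all
  have eq: "bwd_quot i n \<phi> = (\<lambda>x. real (Suc n) *\<^sub>R (?s x - \<phi> x))"
    by (simp add: bwd_quot_def fun_eq_iff)
  have "(bwd_quot i n \<phi> has_derivative
      (\<lambda>v. real (Suc n) *\<^sub>R (frechet_derivative ?s (at x) v - frechet_derivative \<phi> (at x) v))) (at x)" for x
    unfolding eq using R(1) s(1)
    by (intro derivative_intros) (simp_all add: differentiable_on_def frechet_derivative_works)
  note * = this
  show pd: "partial_deriv j (bwd_quot i n \<phi>) = bwd_quot i n (partial_deriv j \<phi>)" for j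
  proof
    fix x
    show "partial_deriv j (bwd_quot i n \<phi>) x = bwd_quot i n (partial_deriv j \<phi>) x"
      using s(2)[of j x] frechet_derivative_at[OF *[of x], symmetric]
      by (simp add: partial_deriv_def bwd_quot_def)
  qed
  have "continuous_on UNIV (partial_deriv j (bwd_quot i n \<phi>))" for j
    unfolding pd bwd_quot_def
    by (intro continuous_intros continuous_on_compose2[OF R(3)]) auto
  moreover have "bwd_quot i n \<phi> differentiable_on UNIV"
    using * by (auto simp: differentiable_on_def differentiable_def)
  moreover have "\<And>x. R + 1 < norm x \<Longrightarrow> bwd_quot i n \<phi> x = 0"
    using bounded_support_bwd_quot R(4) by blast
  ultimately show "C1_compact (bwd_quot i n \<phi>)"
    unfolding C1_compact_def by blast
qed

text \<open>
  Moving a difference quotient in direction \<open>j\<close> from \<open>f\<close> to the test function before taking limits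
  avoids second derivatives, and with them the symmetry of mixed partials.
\<close>

lemma integral_curl_eq_0:
  fixes f \<phi> :: "real ^ 'n \<Rightarrow> real" and g :: "'n \<Rightarrow> real ^ 'n \<Rightarrow> real"
  assumes \<phi>: "C1_compact \<phi>"
    and f: "L-lipschitz_on UNIV f" "\<And>x. \<bar>f x\<bar> \<le> C" and g: "\<And>i. g i \<in> borel_measurable borel"
      "\<And>i. AE x in lborel. (\<lambda>n. fwd_quot i n f x) \<longlonglongrightarrow> g i x" "\<And>i x. \<bar>g i x\<bar> \<le> D"
  shows "(LINT x|lborel. partial_deriv i \<phi> x * g j x) = (LINT x|lborel. partial_deriv j \<phi> x * g i x)"
proof -
  obtain R where R: "\<And>i. continuous_on UNIV (partial_deriv i \<phi>)"
     "\<And>i x. R < norm x \<Longrightarrow> partial_deriv i \<phi> x = 0"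
    using C1_compact_partialE[OF \<phi>] by metis
  have fm: "f \<in> borel_measurable borel"
    using lipschitz_on_continuous_on[OF f(1)] by (simp add: borel_measurable_continuous_onI)
  have eq: "(LINT x|lborel. partial_deriv i \<phi> x * fwd_quot j n f x)
      = - (LINT x|lborel. bwd_quot j n \<phi> x * g i x)" for n
    using integral_by_parts[OF C1_compact_bwd_quot(1)[OF \<phi>] f g(1,2)]
    by (simp add: integral_fwd_quot[OF R fm f(2)] C1_compact_bwd_quot(2)[OF \<phi>])
  have "(\<lambda>n. LINT x|lborel. partial_deriv i \<phi> x * fwd_quot j n f x) \<longlonglongrightarrow> (LINT x|lborel. partial_deriv i \<phi> x * g j x)"
    by (rule integral_fwd_quot_tendsto[OF R f(1) g(1,2)])
  moreover have "(\<lambda>n. LINT x|lborel. partial_deriv i \<phi> x * fwd_quot j n f x) \<longlonglongrightarrow> - (- (LINT x|lborel. partial_deriv j \<phi> x * g i x))"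
    unfolding eq by (intro tendsto_minus integral_bwd_quot_tendsto[OF \<phi> g(1,3)])
  ultimately show ?thesis
    using LIMSEQ_unique by fastforce
qed

lemma test_function_imp_C1_compact:
  assumes "test_function \<phi>"
  shows "C1_compact \<phi>"
proof -
  have "Ck (Suc 0) \<phi>"
    using assms unfolding test_function_def C_infinity_def by blast
  moreover have "bounded {x. \<phi> x \<noteq> 0}"
    using assms unfolding test_function_def by (metis bounded_subset closure_subset compact_imp_bounded)
  then obtain R where "\<And>x. \<phi> x \<noteq> 0 \<Longrightarrow> norm x \<le> R"
    unfolding bounded_iff by blast
  then have "\<forall>x. R < norm x \<longrightarrow> \<phi> x = 0" by force
  ultimately show ?thesis
    unfolding C1_compact_def by auto
qed

section \<open>Piecewise affine functions with prescribed gradients\<close>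

text \<open>A pair encodes an affine function by slope and offset. Requiring that no other member of
  \<open>P\<close> fits excludes the ridges, where \<open>f\<close> may switch between
  members.\<close>

definition piece :: "((real ^ 'n) \<times> real) set \<Rightarrow> (real ^ 'n \<Rightarrow> real) \<Rightarrow> (real ^ 'n) \<times> real \<Rightarrow> (real ^ 'n) set"
  where "piece P f q = {x. f x = fst q \<bullet> x + snd q \<and> (\<forall>q'\<in>P - {q}. f x \<noteq> fst q' \<bullet> x + snd q')}"

text \<open>Off all pieces every summand vanishes, so the value defaults to 0.\<close>

definition piece_grad :: "((real ^ 'n) \<times> real) set \<Rightarrow> (real ^ 'n \<Rightarrow> real) \<Rightarrow> real ^ 'n \<Rightarrow> real ^ 'n"
  where "piece_grad P f x = (\<Sum>q\<in>P. indicator (piece P f q) x *\<^sub>R fst q)"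

lemma piece_grad_eq:
  assumes "finite P" "q \<in> P" "x \<in> piece P f q"
  shows "piece_grad P f x = fst q"
proof -
  have "x \<notin> piece P f q'" if "q' \<in> P" "q' \<noteq> q" for q'
    using assms that by (auto simp: piece_def)
  then have "piece_grad P f x = (\<Sum>q'\<in>P. if q' = q then fst q else 0)"
    unfolding piece_grad_def using assms by (intro sum.cong) auto
  then show ?thesis using assms by simp
qed

lemma piece_grad_eq_0:
  assumes "\<And>q. q \<in> P \<Longrightarrow> x \<notin> piece P f q"
  shows "piece_grad P f x = 0"
  using assms by (simp add: piece_grad_def)

lemma borel_measurable_piece_grad:
  assumes "finite P" "f \<in> borel_measurable borel"
  shows "piece_grad P f \<in> borel_measurable borel"
proof -
  have [measurable]: "f \<in> borel_measurable borel" by fact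
  have "(\<lambda>x. fst q \<bullet> x + snd q) \<in> borel_measurable borel" for q :: "(real ^ 'n) \<times> real"
    by measurable
  note [measurable] = this
  have [measurable]: "piece P f q \<in> sets borel" for q
  proof -
    have "{x \<in> space borel. f x = fst q \<bullet> x + snd q \<and> (\<forall>q'\<in>P - {q}. f x \<noteq> fst q' \<bullet> x + snd q')} \<in> sets borel"
      using assms(1) by (intro sets.sets_Collect_conj sets.sets_Collect_finite_All) measurable
    then show ?thesis by (simp add: piece_def)
  qed
  show ?thesis
    unfolding piece_grad_def by measurable
qed

text \<open>Distinct members of \<open>P\<close> have distinct slopes, so they agree at most on a
  hyperplane, and finitely many hyperplanes are null.\<close>

lemma AE_in_piece:
  assumes P: "finite P" "inj_on fst P" and sel: "\<And>x. \<exists>q\<in>P. f x = fst q \<bullet> x + snd q"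
  shows "AE x in lborel. \<exists>q\<in>P. x \<in> piece P f q"
proof -
  define T where "T = (\<Union>q\<in>P. \<Union>q'\<in>P - {q}. {x. (fst q - fst q') \<bullet> x = snd q' - snd q})"
  have "negligible T"
    unfolding T_def
  proof (rule negligible_Union)
    fix T' assume "T' \<in> (\<lambda>q. \<Union>q'\<in>P - {q}. {x. (fst q - fst q') \<bullet> x = snd q' - snd q}) ` P"
    then obtain q where q: "q \<in> P" "T' = (\<Union>q'\<in>P - {q}. {x. (fst q - fst q') \<bullet> x = snd q' - snd q})"
      by blast
    show "negligible T'"
      unfolding q(2)
    proof (rule negligible_Union)
      fix T'' assume "T'' \<in> (\<lambda>q'. {x. (fst q - fst q') \<bullet> x = snd q' - snd q}) ` (P - {q})"
      then obtain q' where q': "q' \<in> P" "q' \<noteq> q" "T'' = {x. (fst q - fst q') \<bullet> x = snd q' - snd q}"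
        by blast
      then have "fst q - fst q' \<noteq> 0" using P(2) q(1) by (auto dest: inj_onD)
      then show "negligible T''" unfolding q'(3) by (intro negligible_hyperplane disjI1)
    qed (use P(1) in simp)
  qed (use P(1) in simp)
  then have "AE x in lborel. x \<notin> T"
    by (metis AE_completion_iff AE_not_in negligible_iff_null_sets)
  moreover have "\<exists>q\<in>P. x \<in> piece P f q" if "x \<notin> T" for x
  proof -
    obtain q where q: "q \<in> P" "f x = fst q \<bullet> x + snd q" using sel by blast
    have "f x \<noteq> fst q' \<bullet> x + snd q'" if "q' \<in> P - {q}" for q'
    proof
      assume "f x = fst q' \<bullet> x + snd q'"
      then have "(fst q - fst q') \<bullet> x = snd q' - snd q"
        using q by (simp add: inner_diff_left)
      then show False using q that \<open>x \<notin> T\<close> unfolding T_def by blast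
    qed
    then show ?thesis using q unfolding piece_def by blast
  qed
  ultimately show ?thesis by auto
qed

text \<open>By continuity the other members stay excluded near x, so \<open>f\<close> equals one
  affine function there and the quotients are eventually constant.\<close>

lemma fwd_quot_tendsto_piece:
  assumes P: "finite P" and f: "continuous_on UNIV f" and sel: "\<And>x. \<exists>q\<in>P. f x = fst q \<bullet> x + snd q"
    and x: "x \<in> piece P f q"
  shows "(\<lambda>n. fwd_quot i n f x) \<longlonglongrightarrow> fst q $ i"
proof -
  have "eventually (\<lambda>y. \<forall>q'\<in>P - {q}. f y \<noteq> fst q' \<bullet> y + snd q') (nhds x)"
  proof (intro eventually_ball_finite ballI)
    fix q' assume "q' \<in> P - {q}"
    moreover have "open {y. f y \<noteq> fst q' \<bullet> y + snd q'}"
      using f by (intro open_Collect_neq continuous_intros)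
    ultimately show "eventually (\<lambda>y. f y \<noteq> fst q' \<bullet> y + snd q') (nhds x)"
      using x unfolding eventually_nhds piece_def by blast
  qed (use P in simp)
  then have "eventually (\<lambda>y. f y = fst q \<bullet> y + snd q) (nhds x)"
    by eventually_elim (use sel in blast)
  moreover have "(\<lambda>n. x + step i n) \<longlonglongrightarrow> x"
    using tendsto_add[OF tendsto_const step_tendsto_0, of x i] by simp
  ultimately have "eventually (\<lambda>n. f (x + step i n) = fst q \<bullet> (x + step i n) + snd q) sequentially"
    using filterlim_iff by fastforce
  then have "eventually (\<lambda>n. fwd_quot i n f x = fst q $ i) sequentially"
  proof eventually_elim
    case (elim n)
    moreover have "f x = fst q \<bullet> x + snd q" using x by (simp add: piece_def)
    ultimately show ?case
      by (simp add: fwd_quot_def step_eq inner_add_right inner_axis del: of_nat_Suc)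
  qed
  then show ?thesis by (rule tendsto_eventually)
qed

section \<open>Curl-free fields in the plane and the roof over a rectangle\<close>

text \<open>This is the vanishing of the distributional curl. No potential is recorded: the
  condition is linear and survives bounded pointwise limits, as gluing requires.\<close>

definition weak_grad :: "(real ^ 2 \<Rightarrow> real ^ 2) \<Rightarrow> bool"
  where "weak_grad g \<longleftrightarrow> (\<forall>\<phi>. C1_compact \<phi> \<longrightarrow>
    (LINT x|lborel. partial_deriv 1 \<phi> x * g x $ 2) = (LINT x|lborel. partial_deriv 2 \<phi> x * g x $ 1))"

lemma borel_measurable_vec_nth:
  "g \<in> borel_measurable M \<Longrightarrow> (\<lambda>x. g x $ i) \<in> borel_measurable M"
  for g :: "'b \<Rightarrow> real ^ 'n"
  by (rule measurable_compose[of g M borel]) (auto intro!: borel_measurable_continuous_onI continuous_intros)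

lemma weak_grad_piece_grad:
  fixes f :: "real ^ 2 \<Rightarrow> real"
  assumes P: "finite P" "inj_on fst P" and f: "L-lipschitz_on UNIV f" "\<And>x. \<bar>f x\<bar> \<le> C"
    and sel: "\<And>x. \<exists>q\<in>P. f x = fst q \<bullet> x + snd q"
  shows "weak_grad (piece_grad P f)"
proof -
  have cont: "continuous_on UNIV f"
    by (rule lipschitz_on_continuous_on[OF f(1)])
  let ?g = "\<lambda>i x. piece_grad P f x $ i"
  have m: "?g i \<in> borel_measurable borel" for i
    using cont P by (intro borel_measurable_vec_nth borel_measurable_piece_grad borel_measurable_continuous_onI)
  have lim: "AE x in lborel. (\<lambda>n. fwd_quot i n f x) \<longlonglongrightarrow> ?g i x" for i
    using AE_in_piece[OF P sel]
  proof eventually_elim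
    case (elim x)
    then obtain q where "q \<in> P" "x \<in> piece P f q" by blast
    then show ?case
      using fwd_quot_tendsto_piece[OF P(1) cont sel] piece_grad_eq[OF P(1)] by simp
  qed
  have bound: "\<bar>?g i x\<bar> \<le> (\<Sum>q\<in>P. norm (fst q))" for i x
  proof -
    have "\<bar>?g i x\<bar> \<le> norm (piece_grad P f x)" by (rule component_le_norm_cart)
    also have "\<dots> \<le> (\<Sum>q\<in>P. norm (fst q))"
      unfolding piece_grad_def by (intro sum_norm_le) (simp add: indicator_def)
    finally show ?thesis .
  qed
  show ?thesis
    unfolding weak_grad_def using integral_curl_eq_0[OF _ f m lim bound] by blast
qed

text \<open>Four planes rise inwards from the sides of \<open>box c d\<close>, with slopes from
  \<open>r\<close> at the sides through c and from \<open>s\<close> at those through d. For an empty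
  box the minimum is never positive and the roof is 0.\<close>

definition roof :: "real ^ 2 \<Rightarrow> real ^ 2 \<Rightarrow> real ^ 2 \<Rightarrow> real ^ 2 \<Rightarrow> real ^ 2 \<Rightarrow> real"
  where "roof r s c d x = max 0 (min (min (r $ 1 * (x $ 1 - c $ 1)) (s $ 1 * (d $ 1 - x $ 1)))
    (min (r $ 2 * (x $ 2 - c $ 2)) (s $ 2 * (d $ 2 - x $ 2))))"

definition slopes :: "real ^ 2 \<Rightarrow> real ^ 2 \<Rightarrow> (real ^ 2) set"
  where "slopes r s = {axis 1 (r $ 1), axis 1 (- s $ 1), axis 2 (r $ 2), axis 2 (- s $ 2)}"

lemma abs_min_max_diff_le:
  fixes a b a' b' D :: real
  assumes "\<bar>a - a'\<bar> \<le> D" "\<bar>b - b'\<bar> \<le> D"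
  shows "\<bar>min a b - min a' b'\<bar> \<le> D" and "\<bar>max a b - max a' b'\<bar> \<le> D"
  using assms by (auto simp: min_def max_def)

lemma lipschitz_roof:
  assumes "\<And>i. 0 < r $ i" "\<And>i. 0 < s $ i"
  shows "(norm r + norm s)-lipschitz_on UNIV (roof r s c d)"
proof (rule lipschitz_onI)
  fix x y :: "real ^ 2"
  let ?D = "(norm r + norm s) * dist x y"
  have "\<bar>k * (x $ i - y $ i)\<bar> \<le> ?D" if "\<bar>k\<bar> \<le> norm r + norm s" for k i
    using that component_le_norm_cart[of "x - y" i] by (auto simp: abs_mult dist_norm intro!: mult_mono)
  moreover have "\<bar>r $ i\<bar> \<le> norm r + norm s" "\<bar>s $ i\<bar> \<le> norm r + norm s" for i
    using component_le_norm_cart[of r i] component_le_norm_cart[of s i] norm_ge_zero[of r] norm_ge_zero[of s]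
    by linarith+
  ultimately have b: "\<bar>r $ i * (x $ i - y $ i)\<bar> \<le> ?D" "\<bar>s $ i * (x $ i - y $ i)\<bar> \<le> ?D" for i
    by blast+
  have "\<bar>r $ i * (x $ i - c $ i) - r $ i * (y $ i - c $ i)\<bar> \<le> ?D"
    "\<bar>s $ i * (d $ i - x $ i) - s $ i * (d $ i - y $ i)\<bar> \<le> ?D" for i
    using b[of i] by (simp_all add: algebra_simps abs_minus_commute)
  note * = this[of 1] this[of 2]
  have "0 \<le> ?D" by simp
  have "\<bar>max 0 (min (min a1 a2) (min a3 a4)) - max 0 (min (min b1 b2) (min b3 b4))\<bar> \<le> D"
    if "\<bar>a1 - b1\<bar> \<le> D" "\<bar>a2 - b2\<bar> \<le> D" "\<bar>a3 - b3\<bar> \<le> D" "\<bar>a4 - b4\<bar> \<le> D" "0 \<le> D"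
    for a1 a2 a3 a4 b1 b2 b3 b4 D :: real
    using that by (intro abs_min_max_diff_le) simp_all
  then show "dist (roof r s c d x) (roof r s c d y) \<le> ?D"
    unfolding roof_def dist_real_def using * \<open>0 \<le> ?D\<close> by blast
qed simp

lemma roof_pos_iff:
  assumes "\<And>i. 0 < r $ i" "\<And>i. 0 < s $ i"
  shows "0 < roof r s c d x \<longleftrightarrow> x \<in> box c d"
proof -
  have "0 < r $ i * t \<longleftrightarrow> 0 < t" "0 < s $ i * t \<longleftrightarrow> 0 < t" for i t
    using assms[of i] by (simp_all add: zero_less_mult_iff)
  then show ?thesis by (auto simp: roof_def mem_box_cart forall_2 less_max_iff_disj)
qed

text \<open>Membership in \<open>insert 0 S\<close> is demanded at every point, so that a finite
  \<open>S\<close> yields a pointwise bound; the extra value 0 serves the ridges and the outside of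
  \<open>U\<close>.\<close>

definition solves_inclusion ::
    "(real ^ 2) set \<Rightarrow> (real ^ 2) set \<Rightarrow> (real ^ 2 \<Rightarrow> real ^ 2) \<Rightarrow> bool"
  where "solves_inclusion S U g \<longleftrightarrow> g \<in> borel_measurable borel \<and> weak_grad g \<and>
    (\<forall>x. g x \<in> insert 0 S) \<and> (\<forall>x. x \<notin> U \<longrightarrow> g x = 0) \<and> (AE x in lborel. x \<in> U \<longrightarrow> g x \<in> S)"

lemma solves_inclusion_box:
  fixes r s c d :: "real ^ 2"
  assumes pos: "\<And>i. 0 < r $ i" "\<And>i. 0 < s $ i"
  shows "\<exists>g. solves_inclusion (slopes r s) (box c d) g"
proof -
  let ?f = "roof r s c d"
  \<comment> \<open>The pair \<open>(0, 0)\<close> stands for the truncation at 0. Positivity of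
    \<open>r\<close> and \<open>s\<close> makes the five slopes distinct.\<close>
  define P :: "((real ^ 2) \<times> real) set" where "P = {(0, 0), (axis 1 (r $ 1), - r $ 1 * c $ 1), (axis 1 (- s $ 1), s $ 1 * d $ 1),
      (axis 2 (r $ 2), - r $ 2 * c $ 2), (axis 2 (- s $ 2), s $ 2 * d $ 2)}"
  have nz: "r $ 1 > 0" "s $ 1 > 0" "r $ 2 > 0" "s $ 2 > 0" using pos by auto
  have P: "finite P" "inj_on fst P"
    unfolding P_def using nz by (auto simp: inj_on_def axis_eq_axis vec_eq_iff forall_2 axis_def)
  have sel: "\<exists>q\<in>P. ?f x = fst q \<bullet> x + snd q" for x
  proof -
    have "?f x = 0 \<or> ?f x = r $ 1 * (x $ 1 - c $ 1) \<or> ?f x = s $ 1 * (d $ 1 - x $ 1) \<or>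
        ?f x = r $ 2 * (x $ 2 - c $ 2) \<or> ?f x = s $ 2 * (d $ 2 - x $ 2)"
      unfolding roof_def by (metis max_def min_def)
    then show ?thesis by (auto simp: P_def inner_axis' algebra_simps)
  qed
  have fstP: "fst q \<in> slopes r s" if "q \<in> P" "q \<noteq> (0, 0)" for q
    using that by (auto simp: P_def slopes_def)
  have lip: "(norm r + norm s)-lipschitz_on UNIV ?f"
    using lipschitz_roof[OF pos] .
  have nonneg: "0 \<le> ?f x" for x by (simp add: roof_def)
  have bound: "\<bar>?f x\<bar> \<le> r $ 1 * \<bar>d $ 1 - c $ 1\<bar>" for x
  proof (cases "x \<in> box c d")
    case True
    have "?f x \<le> max 0 (r $ 1 * (x $ 1 - c $ 1))"
      unfolding roof_def by (intro max.mono order.refl min.coboundedI1)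
    also have "\<dots> \<le> r $ 1 * \<bar>d $ 1 - c $ 1\<bar>"
    proof -
      have "c $ 1 < x $ 1" "x $ 1 < d $ 1" using True by (auto simp: mem_box_cart)
      then show ?thesis using nz by (intro max.boundedI mult_left_mono) auto
    qed
    finally show ?thesis using nonneg[of x] by simp
  next
    case False
    then have "?f x = 0" using roof_pos_iff[OF pos, of c d x] nonneg[of x] by simp
    then show ?thesis using nz by simp
  qed
  let ?g = "piece_grad P ?f"
  have zero_iff: "?f x = 0" if "x \<in> piece P ?f (0, 0)" for x
    using that by (simp add: piece_def)
  have "solves_inclusion (slopes r s) (box c d) ?g"
    unfolding solves_inclusion_def
  proof (intro conjI allI impI)
    show "?g \<in> borel_measurable borel"
      using P(1) lipschitz_on_continuous_on[OF lip]
      by (intro borel_measurable_piece_grad borel_measurable_continuous_onI)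
    show "weak_grad ?g"
      by (rule weak_grad_piece_grad[OF P lip bound sel])
    show "?g x \<in> insert 0 (slopes r s)" for x
    proof (cases "\<exists>q\<in>P. x \<in> piece P ?f q")
      case True
      then obtain q where "q \<in> P" "x \<in> piece P ?f q" by blast
      then show ?thesis using piece_grad_eq[OF P(1)] fstP by (cases "q = (0, 0)") auto
    qed (simp add: piece_grad_eq_0)
    show "?g x = 0" if "x \<notin> box c d" for x
    proof (cases "\<exists>q\<in>P. x \<in> piece P ?f q")
      case True
      then obtain q where q: "q \<in> P" "x \<in> piece P ?f q" by blast
      \<comment> \<open>Where the roof is 0 the pair \<open>(0, 0)\<close> fits, so the point can
        lie in no other piece.\<close>
      have "?f x = 0" using roof_pos_iff[OF pos, of c d x] nonneg[of x] that by simp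
      moreover have "?f x \<noteq> fst q' \<bullet> x + snd q'" if "q' \<in> P - {q}" for q'
        using q(2) that unfolding piece_def by blast
      from this[of "(0, 0)"] have "?f x \<noteq> 0" if "(0, 0) \<in> P - {q}"
        using that by simp
      ultimately have "q = (0, 0)" by (auto simp: P_def)
      then show ?thesis using piece_grad_eq[OF P(1) q] by simp
    qed (simp add: piece_grad_eq_0)
    show "AE x in lborel. x \<in> box c d \<longrightarrow> ?g x \<in> slopes r s"
      using AE_in_piece[OF P sel]
    proof eventually_elim
      case (elim x)
      then obtain q where q: "q \<in> P" "x \<in> piece P ?f q" by blast
      have "q \<noteq> (0, 0)" if "x \<in> box c d"
        using roof_pos_iff[OF pos, of c d x] that q zero_iff by auto
      then show ?case using piece_grad_eq[OF P(1) q] fstP q by auto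
    qed
  qed
  then show ?thesis by blast
qed

section \<open>Gluing over countably many rectangles\<close>

text \<open>At each point at most one term is nonzero, so the partial sums obey the same bound
  \<open>D\<close> and dominated convergence passes the curl identity to the sum.\<close>

lemma weak_grad_disjoint_sum:
  fixes g :: "nat \<Rightarrow> real ^ 2 \<Rightarrow> real ^ 2"
  assumes U: "disjoint_family U" and supp: "\<And>n x. x \<notin> U n \<Longrightarrow> g n x = 0"
    and g[measurable]: "\<And>n. g n \<in> borel_measurable borel" and bound: "\<And>n x. norm (g n x) \<le> D"
    and weak: "\<And>n. weak_grad (g n)"
  obtains G where "G \<in> borel_measurable borel" "weak_grad G"
    "\<forall>n. \<forall>x\<in>U n. G x = g n x" "\<forall>x. x \<notin> (\<Union>n. U n) \<longrightarrow> G x = 0"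
proof -
  define G where "G x = (\<Sum>n. g n x)" for x
  have other: "g k x = 0" if "x \<in> U n" "k \<noteq> n" for n k x
    using U supp that unfolding disjoint_family_on_def by blast
  have in_U: "(\<lambda>k. g k x) sums g n x" if "x \<in> U n" for n x
  proof -
    have "(\<lambda>k. if k = n then g k x else 0) = (\<lambda>k. g k x)"
      using other[OF that] by auto
    then show ?thesis using sums_single[of n "\<lambda>k. g k x"] by simp
  qed
  have not_U: "g n x = 0" if "x \<notin> (\<Union>n. U n)" for n x
    using supp that by blast
  have sums: "(\<lambda>n. g n x) sums G x" for x
  proof (cases "x \<in> (\<Union>n. U n)")
    case True
    then obtain n where "x \<in> U n" by blast
    from sums_summable[OF in_U[OF this]] show ?thesis
      unfolding G_def by (rule summable_sums)
  next
    case False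
    then show ?thesis using not_U unfolding G_def by simp
  qed
  have partial: "norm (\<Sum>k<N. g k x) \<le> D" for N x
  proof (cases "x \<in> (\<Union>n. U n)")
    case True
    then obtain n where n: "x \<in> U n" by blast
    have "(\<Sum>k<N. g k x) = (\<Sum>k<N. if k = n then g n x else 0)"
      using other[OF n] by (intro sum.cong) auto
    then show ?thesis using bound[of n x] norm_ge_zero[of "g n x"]
      by (auto intro: order_trans[OF norm_ge_zero bound])
  next
    case False
    then show ?thesis using not_U order_trans[OF norm_ge_zero bound] by simp
  qed
  have G[measurable]: "G \<in> borel_measurable borel"
    by (rule borel_measurable_LIMSEQ_metric[where f = "\<lambda>N x. \<Sum>k<N. g k x"]) (use sums in \<open>auto simp: sums_def\<close>)
  have lim: "(\<lambda>N. \<Sum>k<N. (LINT x|lborel. \<psi> x * g k x $ i)) \<longlonglongrightarrow> (LINT x|lborel. \<psi> x * G x $ i)"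
    if \<psi>: "integrable lborel \<psi>" for \<psi> :: "real ^ 2 \<Rightarrow> real" and i
  proof -
    have [measurable]: "\<psi> \<in> borel_measurable borel" using \<psi> by (simp add: integrable_iff_bounded)
    have [measurable]: "(\<lambda>x. G x $ i) \<in> borel_measurable borel" "(\<lambda>x. g k x $ i) \<in> borel_measurable borel" for k
      by (intro borel_measurable_vec_nth G g)+
    have comp: "\<bar>v $ i\<bar> \<le> D" if "norm v \<le> D" for v :: "real ^ 2"
      using component_le_norm_cart[of v i] that by simp
    have int: "integrable lborel (\<lambda>x. \<psi> x * g k x $ i)" for k
    proof (rule Bochner_Integration.integrable_bound)
      show "integrable lborel (\<lambda>x. \<psi> x * D)" using \<psi> by simp
      have "norm (\<psi> x * g k x $ i) \<le> norm (\<psi> x * D)" for x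
        using comp[OF bound[of k x]] by (auto simp: abs_mult intro!: mult_left_mono)
      then show "AE x in lborel. norm (\<psi> x * g k x $ i) \<le> norm (\<psi> x * D)" by simp
    qed measurable
    have "(\<lambda>N. LINT x|lborel. \<psi> x * (\<Sum>k<N. g k x) $ i) \<longlonglongrightarrow> (LINT x|lborel. \<psi> x * G x $ i)"
    proof (rule integral_dominated_convergence[where w = "\<lambda>x. \<bar>\<psi> x\<bar> * D"])
      show "AE x in lborel. (\<lambda>N. \<psi> x * (\<Sum>k<N. g k x) $ i) \<longlonglongrightarrow> \<psi> x * G x $ i"
        using sums unfolding sums_def by (intro AE_I2 tendsto_intros) auto
      show "AE x in lborel. norm (\<psi> x * (\<Sum>k<N. g k x) $ i) \<le> \<bar>\<psi> x\<bar> * D" for N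
        using comp[OF partial] by (auto simp: abs_mult intro!: mult_left_mono simp del: sum_component)
    qed (use \<psi> in simp_all)
    moreover have "(LINT x|lborel. \<psi> x * (\<Sum>k<N. g k x) $ i) = (\<Sum>k<N. (LINT x|lborel. \<psi> x * g k x $ i))" for N
      using int by (simp add: sum_distrib_left Bochner_Integration.integral_sum)
    ultimately show ?thesis by simp
  qed
  have "weak_grad G"
    unfolding weak_grad_def
  proof (intro allI impI)
    fix \<phi> :: "real ^ 2 \<Rightarrow> real" assume \<phi>: "C1_compact \<phi>"
    obtain R where R: "\<And>i. continuous_on UNIV (partial_deriv i \<phi>)"
      "\<And>i x. R < norm x \<Longrightarrow> partial_deriv i \<phi> x = 0"
      using C1_compact_partialE[OF \<phi>] by metis
    have "integrable lborel (partial_deriv i \<phi>)" for i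
    proof -
      obtain B where "\<And>x. \<bar>partial_deriv i \<phi> x\<bar> \<le> B"
        using bounded_if_continuous_compact_support[OF R] by blast
      then show ?thesis
        using R by (intro integrable_if_bounded_support borel_measurable_continuous_onI)
    qed
    note lim = lim[OF this]
    show "(LINT x|lborel. partial_deriv 1 \<phi> x * G x $ 2) = (LINT x|lborel. partial_deriv 2 \<phi> x * G x $ 1)"
      using lim[of 1 2] lim[of 2 1] weak \<phi> unfolding weak_grad_def by (simp add: LIMSEQ_unique)
  qed
  moreover have "\<forall>n. \<forall>x\<in>U n. G x = g n x"
    using sums_unique2[OF sums in_U] by blast
  moreover have "\<forall>x. x \<notin> (\<Union>n. U n) \<longrightarrow> G x = 0"
    using not_U by (simp add: G_def)
  ultimately show ?thesis by (intro that[OF G])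
qed

text \<open>The covering lemma gives countably many dyadic cells with disjoint interiors; passing to
  the interiors loses only a null set.\<close>

lemma open_set_disjoint_boxes:
  fixes \<Omega> :: "'a::euclidean_space set"
  assumes "bounded \<Omega>" "open \<Omega>"
  obtains U :: "nat \<Rightarrow> 'a set" where "disjoint_family U" "\<forall>n. \<exists>c d. U n = box c d"
    "(\<Union>n. U n) \<subseteq> \<Omega>" "AE x in lborel. x \<in> \<Omega> \<longrightarrow> x \<in> (\<Union>n. U n)"
proof -
  obtain a where a: "\<Omega> \<subseteq> cbox (- a) a"
    using bounded_subset_cbox_symmetric[OF assms(1)] by blast
  \<comment> \<open>Inserting 0 keeps the open box nonempty, as the covering lemma demands, even if
    \<Omega> is empty.\<close>
  obtain b where b: "cbox (- a) a \<subseteq> box (- b) b" and ne: "box (- b) b \<noteq> {}"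
  proof -
    obtain b where "insert 0 (cbox (- a) a) \<subseteq> box (- b) b"
      using bounded_subset_box_symmetric[of "insert 0 (cbox (- a) a)"] by auto
    then show thesis using that by blast
  qed
  have sub: "\<Omega> \<subseteq> cbox (- b) b"
    using a b box_subset_cbox by blast
  \<comment> \<open>Each cell has a tag in \<Omega>, and this gauge then forces the whole cell into
    \<Omega>.\<close>
  have g: "gauge (\<lambda>x. if x \<in> \<Omega> then \<Omega> else UNIV)"
    using assms(2) by (auto simp: gauge_def)
  obtain \<D> where \<D>: "countable \<D>" "\<Union>\<D> \<subseteq> cbox (- b) b"
    "\<And>K. K \<in> \<D> \<Longrightarrow> interior K \<noteq> {} \<and> (\<exists>c d. K = cbox c d)"
    "pairwise (\<lambda>A B. interior A \<inter> interior B = {}) \<D>"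
    "\<And>K. K \<in> \<D> \<Longrightarrow> \<exists>x\<in>\<Omega> \<inter> K. K \<subseteq> (if x \<in> \<Omega> then \<Omega> else UNIV)"
    "\<And>u v. cbox u v \<in> \<D> \<Longrightarrow> \<exists>n. \<forall>i\<in>Basis. v \<bullet> i - u \<bullet> i = (b \<bullet> i - (- b) \<bullet> i) / 2 ^ n"
    "\<Omega> \<subseteq> \<Union>\<D>"
  proof (rule covering_lemma[OF sub ne g], goal_cases)
    case (1 \<D>)
    show ?case by (rule 1(1)) (fact 1)+
  qed
  \<comment> \<open>The family may be finite; indices that enumerate no cell get the empty set,
    itself a box.\<close>
  define U where "U n = (if n \<in> to_nat_on \<D> ` \<D> then interior (from_nat_into \<D> n) else {})" for n
  have U_eq: "U (to_nat_on \<D> K) = interior K" if "K \<in> \<D>" for K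
    using that \<D>(1) by (simp add: U_def)
  have U_cases: "U n = {} \<or> (\<exists>K\<in>\<D>. n = to_nat_on \<D> K \<and> U n = interior K)" for n
    using U_eq by (auto simp: U_def)
  have "disjoint_family U"
    unfolding disjoint_family_on_def
  proof (intro ballI impI)
    fix m n :: nat assume "m \<noteq> n"
    consider "U m = {} \<or> U n = {}" | K L where "K \<in> \<D>" "m = to_nat_on \<D> K" "U m = interior K"
        "L \<in> \<D>" "n = to_nat_on \<D> L" "U n = interior L"
      using U_cases[of m] U_cases[of n] by blast
    then show "U m \<inter> U n = {}"
    proof cases
      case 2
      then show ?thesis using pairwiseD[OF \<D>(4), of K L] \<open>m \<noteq> n\<close> by auto
    qed auto
  qed
  moreover have "\<forall>n. \<exists>c d. U n = box c d"
  proof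
    fix n
    show "\<exists>c d. U n = box c d"
      using U_cases[of n]
    proof
      assume "U n = {}"
      then have "U n = box 0 0" by simp
      then show ?thesis by blast
    next
      assume "\<exists>K\<in>\<D>. n = to_nat_on \<D> K \<and> U n = interior K"
      then show ?thesis using \<D>(3) interior_cbox by metis
    qed
  qed
  moreover have "(\<Union>n. U n) \<subseteq> \<Omega>"
  proof (intro UN_least)
    fix n show "U n \<subseteq> \<Omega>"
      using U_cases[of n]
    proof
      assume "\<exists>K\<in>\<D>. n = to_nat_on \<D> K \<and> U n = interior K"
      then obtain K where K: "K \<in> \<D>" "U n = interior K" by blast
      then have "K \<subseteq> \<Omega>" using \<D>(5)[of K] by auto
      then show ?thesis using K interior_subset by blast
    qed simp
  qed
  moreover have "AE x in lborel. x \<in> \<Omega> \<longrightarrow> x \<in> (\<Union>n. U n)"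
  proof -
    have "(\<Union>K\<in>\<D>. K - interior K) \<in> null_sets lborel"
    proof (rule null_sets_UN'[OF \<D>(1)])
      fix K assume "K \<in> \<D>"
      then obtain c d where "K = cbox c d" using \<D>(3) by blast
      then show "K - interior K \<in> null_sets lborel"
        using null_sets_cbox_Diff_box[of c d] by simp
    qed
    then have "AE x in lborel. x \<notin> (\<Union>K\<in>\<D>. K - interior K)"
      by (rule AE_not_in)
    then show ?thesis
    proof eventually_elim
      case (elim x)
      show ?case
      proof
        assume "x \<in> \<Omega>"
        then obtain K where K: "K \<in> \<D>" "x \<in> K" using \<D>(7) by blast
        then have "x \<in> U (to_nat_on \<D> K)" using elim U_eq by simp
        then show "x \<in> (\<Union>n. U n)" by blast
      qed
    qed
  qed
  ultimately show ?thesis by (rule that)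
qed

text \<open>The slopes depend neither on the size nor on the position of a rectangle, so one bound
  serves all cells.\<close>

lemma solves_inclusion_open:
  fixes r s :: "real ^ 2"
  assumes \<Omega>: "bounded \<Omega>" "open \<Omega>" and pos: "\<And>i. 0 < r $ i" "\<And>i. 0 < s $ i"
  shows "\<exists>g. solves_inclusion (slopes r s) \<Omega> g"
proof -
  obtain U :: "nat \<Rightarrow> (real ^ 2) set" where U: "disjoint_family U" "\<forall>n. \<exists>c d. U n = box c d"
    "(\<Union>n. U n) \<subseteq> \<Omega>" "AE x in lborel. x \<in> \<Omega> \<longrightarrow> x \<in> (\<Union>n. U n)"
    by (rule open_set_disjoint_boxes[OF \<Omega>])
  have "\<exists>g. solves_inclusion (slopes r s) (U n) g" for n
    using U(2) solves_inclusion_box[OF pos] by metis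
  then obtain g where "\<And>n. solves_inclusion (slopes r s) (U n) (g n)" by metis
  then have g: "\<And>n. g n \<in> borel_measurable borel" "\<And>n. weak_grad (g n)"
    "\<And>n x. g n x \<in> insert 0 (slopes r s)" "\<And>n x. x \<notin> U n \<Longrightarrow> g n x = 0"
    "\<And>n. AE x in lborel. x \<in> U n \<longrightarrow> g n x \<in> slopes r s"
    unfolding solves_inclusion_def by simp_all
  have "finite (insert 0 (slopes r s))" by (simp add: slopes_def)
  then obtain D where D: "\<forall>v\<in>insert 0 (slopes r s). norm v \<le> D"
    using finite_imp_bounded[of "insert 0 (slopes r s)"] unfolding bounded_iff by metis
  have bound: "norm (g n x) \<le> D" for n x
    by (rule D[rule_format]) (rule g(3))
  obtain G where G: "G \<in> borel_measurable borel" "weak_grad G"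
    "\<forall>n. \<forall>x\<in>U n. G x = g n x" "\<forall>x. x \<notin> (\<Union>n. U n) \<longrightarrow> G x = 0"
    by (rule weak_grad_disjoint_sum[OF U(1) g(4,1) bound g(2)])
  have "solves_inclusion (slopes r s) \<Omega> G"
    unfolding solves_inclusion_def
  proof (intro conjI allI impI)
    show "G x \<in> insert 0 (slopes r s)" for x
    proof (cases "x \<in> (\<Union>n. U n)")
      case True
      then show ?thesis using G(3) g(3) by (metis UN_E)
    qed (use G(4) in simp)
    show "G x = 0" if "x \<notin> \<Omega>" for x
      using G(4) U(3) that by blast
    have "AE x in lborel. \<forall>n. x \<in> U n \<longrightarrow> g n x \<in> slopes r s"
      using g(5) by (simp add: AE_all_countable)
    with U(4) show "AE x in lborel. x \<in> \<Omega> \<longrightarrow> G x \<in> slopes r s"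
      by eventually_elim (use G(3) in auto)
  qed (fact G)+
  then show ?thesis by blast
qed

section \<open>Convexity along the characteristic cone\<close>

lemma symbol_mult_vec:
  "principal_symbol A1 A2 w *v v = w $ 1 *\<^sub>R (A1 *v v) + w $ 2 *\<^sub>R (A2 *v v)"
  by (simp add: principal_symbol_def matrix_vector_mult_add_rdistrib scaleR_matrix_vector_assoc)

text \<open>With both sine and cosine the family is closed under partial derivatives, so smoothness
  is an induction over arbitrary coefficients.\<close>

definition plane_wave :: "real ^ 'n \<Rightarrow> 'b::real_normed_vector \<Rightarrow> real \<Rightarrow> real \<Rightarrow> real ^ 'n \<Rightarrow> 'b"
  where "plane_wave c v \<alpha> \<beta> x = (\<alpha> * sin (c \<bullet> x) + \<beta> * cos (c \<bullet> x)) *\<^sub>R v"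

lemma has_derivative_plane_wave:
  "(plane_wave c v \<alpha> \<beta> has_derivative
    (\<lambda>h. ((c \<bullet> h) * (\<alpha> * cos (c \<bullet> x) - \<beta> * sin (c \<bullet> x))) *\<^sub>R v)) (at x)"
  unfolding plane_wave_def[abs_def]
  by (auto intro!: derivative_eq_intros simp: algebra_simps fun_eq_iff)

lemma partial_deriv_plane_wave:
  "partial_deriv i (plane_wave c v \<alpha> \<beta>) = plane_wave c v (- \<beta> * c $ i) (\<alpha> * c $ i)"
  by (rule ext)
    (simp add: partial_deriv_def frechet_derivative_at[OF has_derivative_plane_wave, symmetric]
      plane_wave_def inner_axis algebra_simps)

lemma C_infinity_plane_wave: "C_infinity (plane_wave c v \<alpha> \<beta>)"
proof -
  have diff: "plane_wave c v \<alpha> \<beta> differentiable_on UNIV" for \<alpha> \<beta>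
    using has_derivative_plane_wave unfolding differentiable_on_def differentiable_def by blast
  have "Ck k (plane_wave c v \<alpha> \<beta>)" for k
  proof (induction k arbitrary: \<alpha> \<beta>)
    case 0
    then show ?case using diff differentiable_imp_continuous_on by simp blast
  next
    case (Suc k)
    then show ?case using diff by (simp add: partial_deriv_plane_wave)
  qed
  then show ?thesis by (simp add: C_infinity_def)
qed

section \<open>Integration over the unit square\<close>

lemma unit_square_eq_box: "unit_square = box 0 1"
  by (auto simp: unit_square_def mem_box_cart)

lemma emeasure_unit_square: "emeasure lborel unit_square = 1"
proof -
  have "(1 :: real ^ 2) \<bullet> b = 1" if "b \<in> Basis" for b
    using that by (auto simp: Basis_vec_def inner_axis)
  then show ?thesis
    unfolding unit_square_eq_box by (subst emeasure_lborel_box) (simp_all)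
qed

lemma sets_unit_square [measurable]: "unit_square \<in> sets borel"
  by (simp add: unit_square_eq_box)

lemma unit_square_nonempty: "unit_square \<noteq> {}"
  using emeasure_unit_square by force

lemma integral_unit_square_lborel:
  fixes f :: "real ^ 2 \<Rightarrow> 'b::euclidean_space"
  assumes [measurable]: "f \<in> borel_measurable borel"
  shows "(LINT x:unit_square|lebesgue. f x) = (LINT x:unit_square|lborel. f x)"
  unfolding set_lebesgue_integral_def by (rule integral_completion) measurable

lemma set_integrable_unit_square:
  fixes f :: "real ^ 2 \<Rightarrow> 'b::euclidean_space"
  assumes "continuous_on UNIV f"
  shows "set_integrable lborel unit_square f"
proof -
  have "set_integrable lborel (cbox 0 1) f"
    using assms by (intro borel_integrable_compact[unfolded set_integrable_def[symmetric]])
      (auto intro: continuous_on_subset)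
  then show ?thesis
    by (rule set_integrable_subset) (auto simp: unit_square_eq_box box_subset_cbox)
qed

text \<open>The reflection of x to \<open>1 - x\<close> preserves the square and Lebesgue measure;
  integrality of \<open>k\<close> makes the sine odd under it.\<close>

lemma integral_sin_unit_square:
  fixes k :: "real ^ 2"
  assumes "\<And>i. k $ i \<in> \<int>"
  shows "sin ((2 * pi) *\<^sub>R k \<bullet> (1 - x)) = - sin ((2 * pi) *\<^sub>R k \<bullet> x)"
    and "(LINT x:unit_square|lborel. sin ((2 * pi) *\<^sub>R k \<bullet> x)) = 0"
proof -
  let ?c = "(2 * pi) *\<^sub>R k"
  obtain n where n: "k $ 1 + k $ 2 = of_int n"
    using assms by (metis Ints_add Ints_cases)
  have "?c \<bullet> (1 - x) = (2 * pi) * of_int n - ?c \<bullet> x" for x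
    by (simp add: inner_diff_right inner_vec_def[of k 1] sum_2 n)
  note eq = this
  show refl: "sin (?c \<bullet> (1 - x)) = - sin (?c \<bullet> x)" for x
    unfolding eq sin_diff sin_int_2pin cos_int_2pin by simp
  let ?f = "\<lambda>x :: real ^ 2. indicator unit_square x *\<^sub>R sin (?c \<bullet> x)"
  have "lborel = density (distr lborel borel (\<lambda>x :: real ^ 2. 1 + (- 1) *\<^sub>R x)) (\<lambda>_. ennreal (\<bar>- 1 :: real\<bar> ^ DIM(real ^ 2)))"
    by (rule lborel_affine) simp
  then have lborel_eq: "(lborel :: (real ^ 2) measure) = distr lborel borel (\<lambda>x. 1 - x)"
    by (simp add: density_1)
  have "(LINT x|lborel. ?f x) = (LINT x|distr lborel borel (\<lambda>x. 1 - x). ?f x)"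
    by (simp flip: lborel_eq)
  also have "\<dots> = (LINT x|lborel. ?f (1 - x))"
    by (rule integral_distr) measurable
  also have "\<dots> = (LINT x|lborel. - ?f x)"
    unfolding refl by (rule arg_cong[where f = "integral\<^sup>L lborel"])
      (auto simp: fun_eq_iff indicator_def unit_square_def)
  finally show "(LINT x:unit_square|lborel. sin (?c \<bullet> x)) = 0"
    unfolding set_lebesgue_integral_def by simp
qed

text \<open>The zeros of the sine lie on countably many hyperplanes, a null set. At a point where
  the sine is negative, the reflection makes it positive.\<close>

lemma exists_sin_pos:
  fixes k :: "real ^ 2"
  assumes k: "\<And>i. k $ i \<in> \<int>" "k \<noteq> 0"
  obtains x where "x \<in> unit_square" "0 < sin ((2 * pi) *\<^sub>R k \<bullet> x)"
proof -
  let ?c = "(2 * pi) *\<^sub>R k"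
  have "{x. sin (?c \<bullet> x) = 0} = \<Union> (range (\<lambda>i :: int. {x. ?c \<bullet> x = of_int i * pi}))"
    by (auto simp: sin_zero_iff_int2)
  also have "negligible \<dots>"
    using k(2) by (intro negligible_countable_Union) (auto intro!: negligible_hyperplane simp del: inner_scaleR_left)
  finally have "\<not> unit_square \<subseteq> {x. sin (?c \<bullet> x) = 0}"
    using open_not_negligible[of unit_square] negligible_subset unit_square_nonempty
    by (metis open_box unit_square_eq_box)
  then obtain x where x: "x \<in> unit_square" "sin (?c \<bullet> x) \<noteq> 0" by blast
  have "1 - x \<in> unit_square" using x(1) by (simp add: unit_square_def)
  then show ?thesis
    using that x integral_sin_unit_square(1)[OF k(1), of x] by (cases "0 < sin (?c \<bullet> x)") auto
qed

text \<open>
  Maximum principle: at the largest maximiser of the deviation of \<open>F\<close> from its chord,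
  oscillating along a periodic plane wave would strictly decrease the mean.
\<close>

lemma A_quasiconvex_convex_integer_direction:
  fixes A1 A2 :: "real ^ 'd ^ 'm"
  assumes F: "continuous_on UNIV F" "A_quasiconvex A1 A2 F"
    and k: "\<And>i. k $ i \<in> \<int>" "k \<noteq> 0" and v: "principal_symbol A1 A2 k *v v = 0"
    and t: "0 \<le> t" "t \<le> 1"
  shows "F (a + t *\<^sub>R v) \<le> (1 - t) * F a + t * F (a + v)"
proof (rule ccontr)
  let ?c = "(2 * pi) *\<^sub>R k"
  define \<phi> where "\<phi> s = F (a + s *\<^sub>R v) - ((1 - s) * F a + s * F (a + v))" for s
  have cont: "continuous_on X \<phi>" for X
    unfolding \<phi>_def by (intro continuous_intros continuous_on_compose2[OF F(1)]) auto
  assume "\<not> ?thesis"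
  then have "0 < \<phi> t" by (simp add: \<phi>_def)
  obtain m where m: "m \<in> {0..1}" "\<forall>s\<in>{0..1}. \<phi> s \<le> \<phi> m"
    using continuous_attains_sup[OF _ _ cont, of "{0..1::real}"] by auto
  have "0 < \<phi> m" using m(2) t \<open>0 < \<phi> t\<close> by (meson atLeastAtMost_iff less_le_trans)
  \<comment> \<open>Taking the last maximiser ensures that any move to the right strictly lowers
    \<phi>.\<close>
  have "compact {s \<in> {0..1}. \<phi> s = \<phi> m}"
    using continuous_closed_preimage_constant[OF cont closed_real_atLeastAtMost, of 0 1 "\<phi> m"]
    by (auto simp: compact_eq_bounded_closed intro: bounded_subset[OF bounded_closed_interval])
  then have "\<exists>\<tau>\<in>{s \<in> {0..1}. \<phi> s = \<phi> m}. \<forall>s\<in>{s \<in> {0..1}. \<phi> s = \<phi> m}. s \<le> \<tau>"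
    using m(1) by (intro compact_attains_sup) blast+
  then obtain \<tau> where \<tau>: "\<tau> \<in> {0..1}" "\<phi> \<tau> = \<phi> m" "\<forall>s\<in>{0..1}. \<phi> s = \<phi> m \<longrightarrow> s \<le> \<tau>"
    by blast
  have "\<phi> 0 = 0" "\<phi> 1 = 0" by (simp_all add: \<phi>_def)
  then have "\<tau> \<noteq> 0" "\<tau> \<noteq> 1"
    using \<tau>(2) \<open>0 < \<phi> m\<close> by (metis less_irrefl)+
  then have "0 < \<tau>" "\<tau> < 1"
    using \<tau>(1) by simp_all
  \<comment> \<open>The largest amplitude that keeps the oscillation about \<tau> inside the unit
    interval.\<close>
  define r where "r = min \<tau> (1 - \<tau>)"
  have r: "0 < r" "r \<le> \<tau>" "r \<le> 1 - \<tau>" using \<open>0 < \<tau>\<close> \<open>\<tau> < 1\<close> by (auto simp: r_def)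
  have range: "\<tau> + r * y \<in> {0..1}" if "- 1 \<le> y" "y \<le> 1" for y
  proof -
    have "r * y \<le> r * 1" "r * (- 1) \<le> r * y" using that r by (intro mult_left_mono; simp)+
    then show ?thesis unfolding atLeastAtMost_iff using r by linarith
  qed
  define \<psi> where "\<psi> x = \<phi> (\<tau> + r * sin (?c \<bullet> x))" for x
  have \<psi>_cont: "continuous_on UNIV \<psi>"
    unfolding \<psi>_def by (intro continuous_on_compose2[OF cont[of UNIV]] continuous_intros) auto
  have \<psi>_le: "\<psi> x \<le> \<phi> m" for x
    unfolding \<psi>_def using m(2) range[of "sin (?c \<bullet> x)"] by simp
  define w where "w = plane_wave ?c v r 0"
  have w: "w x = (r * sin (?c \<bullet> x)) *\<^sub>R v" for x by (simp add: w_def plane_wave_def)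
  have w_cont: "continuous_on UNIV w"
    unfolding w[abs_def] by (intro continuous_intros)
  have sin_int: "set_integrable lborel unit_square (\<lambda>x :: real ^ 2. sin (?c \<bullet> x))"
    by (intro set_integrable_unit_square continuous_intros)
  have "Q_periodic w"
    unfolding Q_periodic_def
  proof (intro allI)
    fix x i
    obtain n where n: "k $ i = of_int n" using k(1) Ints_cases by metis
    have "?c \<bullet> (x + axis i 1) = ?c \<bullet> x + (2 * pi) * of_int n"
      by (simp add: inner_add_right inner_axis n)
    then have "sin (?c \<bullet> (x + axis i 1)) = sin (?c \<bullet> x)"
      unfolding \<open>?c \<bullet> (x + axis i 1) = _\<close> sin_add cos_int_2pin sin_int_2pin by simp
    then show "w (x + axis i 1) = w x"
      unfolding w by simp
  qed
  moreover have "diff_op A1 A2 w x = 0" for x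
  proof -
    have "diff_op A1 A2 w x = (2 * pi * r * cos (?c \<bullet> x)) *\<^sub>R (principal_symbol A1 A2 k *v v)"
      by (simp add: diff_op_def w_def partial_deriv_plane_wave symbol_mult_vec plane_wave_def
          matrix_vector_mult_scaleR scaleR_add_right mult_ac)
    then show ?thesis using v by simp
  qed
  moreover have "(LINT x:unit_square|lebesgue. w x) = 0"
  proof -
    have "(LINT x:unit_square|lebesgue. w x) = (LINT x:unit_square|lborel. w x)"
      using w_cont by (intro integral_unit_square_lborel borel_measurable_continuous_onI)
    also have "\<dots> = (LINT x:unit_square|lborel. r * sin (?c \<bullet> x)) *\<^sub>R v"
    proof -
      have "integrable lborel (\<lambda>x. indicator unit_square x *\<^sub>R (r * sin (?c \<bullet> x)))"
        using set_integrable_mult_right[OF sin_int, of r] by (simp add: set_integrable_def)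
      then show ?thesis
        unfolding set_lebesgue_integral_def w scaleR_scaleR[symmetric] real_scaleR_def
        by (simp only: integral_scaleR_left scaleR_scaleR)
    qed
    finally show ?thesis
      using integral_sin_unit_square(2)[OF k(1)] by simp
  qed
  ultimately have "F (a + \<tau> *\<^sub>R v) \<le> (LINT x:unit_square|lebesgue. F (a + \<tau> *\<^sub>R v + w x))"
    using F(2) C_infinity_plane_wave unfolding A_quasiconvex_def w_def by blast
  also have "\<dots> = (LINT x:unit_square|lborel. F (a + \<tau> *\<^sub>R v + w x))"
    by (intro integral_unit_square_lborel borel_measurable_continuous_onI
        continuous_on_compose2[OF F(1)] continuous_intros w_cont) auto
  \<comment> \<open>The chord is affine in the wave, so after integration only its value at \<tau>
    remains.\<close>
  also have "\<dots> = (LINT x:unit_square|lborel. \<psi> x + (((1 - \<tau>) * F a + \<tau> * F (a + v)) +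
      (r * (F (a + v) - F a)) * sin (?c \<bullet> x)))"
    unfolding w \<psi>_def \<phi>_def by (simp add: algebra_simps)
  also have "\<dots> = (LINT x:unit_square|lborel. \<psi> x) + ((1 - \<tau>) * F a + \<tau> * F (a + v))"
  proof -
    have "set_integrable lborel unit_square \<psi>"
      "set_integrable lborel unit_square (\<lambda>_ :: real ^ 2. (1 - \<tau>) * F a + \<tau> * F (a + v))"
      "set_integrable lborel unit_square (\<lambda>x :: real ^ 2. (r * (F (a + v) - F a)) * sin (?c \<bullet> x))"
      by (intro set_integrable_unit_square \<psi>_cont continuous_intros)+
    moreover have "measure lborel unit_square = 1"
      using emeasure_unit_square by (simp add: measure_def)
    ultimately show ?thesis
      using integral_sin_unit_square(2)[OF k(1)]
      by (simp add: set_integral_add emeasure_unit_square set_integral_const)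
  qed
  finally have "\<phi> m \<le> (LINT x:unit_square|lborel. \<psi> x)"
    using \<tau>(2) by (simp add: \<phi>_def)
  \<comment> \<open>\<psi> never exceeds \<phi> m, yet its mean is at least \<phi> m; hence the gap
    vanishes almost everywhere.\<close>
  define gap where "gap x = indicator unit_square x * (\<phi> m - \<psi> x)" for x
  have "set_integrable lborel unit_square (\<lambda>x. \<phi> m - \<psi> x)"
    by (intro set_integrable_unit_square \<psi>_cont continuous_intros)
  then have gap_int: "integrable lborel gap"
    by (simp add: set_integrable_def gap_def[abs_def])
  have "integral\<^sup>L lborel gap = (LINT x:unit_square|lborel. \<phi> m - \<psi> x)"
    by (simp add: set_lebesgue_integral_def gap_def[abs_def])
  also have "\<dots> = \<phi> m - (LINT x:unit_square|lborel. \<psi> x)"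
  proof -
    have "set_integrable lborel unit_square \<psi>" "set_integrable lborel unit_square (\<lambda>_ :: real ^ 2. \<phi> m)"
      by (intro set_integrable_unit_square \<psi>_cont continuous_intros)+
    moreover have "measure lborel unit_square = 1"
      using emeasure_unit_square by (simp add: measure_def)
    ultimately show ?thesis
      by (simp add: set_integral_diff emeasure_unit_square set_integral_const)
  qed
  finally have "integral\<^sup>L lborel gap \<le> 0"
    using \<open>\<phi> m \<le> _\<close> by simp
  moreover have gap_nonneg: "0 \<le> gap x" for x
    using \<psi>_le[of x] by (simp add: gap_def)
  ultimately have "integral\<^sup>L lborel gap = 0"
    by (simp add: integral_nonneg antisym)
  then have ae: "AE x in lborel. gap x = 0"
    using integral_nonneg_eq_0_iff_AE[OF gap_int] gap_nonneg by simp
  \<comment> \<open>An open null set is empty, so the gap vanishes everywhere in the square, in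
    particular where the sine is positive.\<close>
  have open_neq: "open {x \<in> unit_square. \<psi> x \<noteq> \<phi> m}"
  proof -
    have "open (unit_square \<inter> {x. \<psi> x \<noteq> \<phi> m})"
      unfolding unit_square_eq_box by (intro open_Int open_box open_Collect_neq \<psi>_cont continuous_intros)
    then show ?thesis by (simp add: Collect_conj_eq)
  qed
  have "AE x in lborel. x \<notin> {x \<in> unit_square. \<psi> x \<noteq> \<phi> m}"
    using ae by eventually_elim (auto simp: gap_def)
  then have "{x \<in> unit_square. \<psi> x \<noteq> \<phi> m} \<in> null_sets lborel"
    using open_neq by (subst AE_iff_null_sets) auto
  then have "negligible {x \<in> unit_square. \<psi> x \<noteq> \<phi> m}"
    unfolding negligible_iff_null_sets by (rule null_sets_completionI)
  then have "{x \<in> unit_square. \<psi> x \<noteq> \<phi> m} = {}"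
    using open_neq open_not_negligible by blast
  moreover obtain x where x: "x \<in> unit_square" "0 < sin (?c \<bullet> x)"
    by (rule exists_sin_pos[OF k])
  ultimately have "\<psi> x = \<phi> m" by blast
  then have "\<tau> + r * sin (?c \<bullet> x) \<le> \<tau>"
    unfolding \<psi>_def using \<tau>(3) range[of "sin (?c \<bullet> x)", OF sin_ge_minus_one sin_le_one] by blast
  then show False using mult_pos_pos[OF r(1) x(2)] by linarith
qed

section \<open>Directions of the cone and approximation of frequencies\<close>

text \<open>The kernel condition gives injectivity, and equality of dimensions then gives
  surjectivity.\<close>

lemma symbol_right_inverse:
  fixes A1 A2 :: "real ^ 'd ^ 'm"
  assumes dim: "CARD('d) = 2 * CARD('m)"
    and ker: "{v. A1 *v v = 0} \<inter> {v. A2 *v v = 0} = {0}"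
  obtains T where "linear T" "\<forall>p q. A1 *v T (p, q) = p \<and> A2 *v T (p, q) = q"
    "\<forall>v. T (A1 *v v, A2 *v v) = v"
proof -
  define S where "S v = (A1 *v v, A2 *v v)" for v
  have S: "linear S"
    unfolding S_def by (intro linearI) (simp_all add: matrix_vector_right_distrib matrix_vector_mult_scaleR)
  have "inj S"
    unfolding linear_injective_0[OF S] using ker by (auto simp: S_def zero_prod_def)
  have "dim (range S) = DIM((real ^ 'm) \<times> (real ^ 'm))"
    using dim dim_image_eq[OF S, of UNIV] \<open>inj S\<close> by (simp add: dim_UNIV)
  then have "range S = UNIV"
    using S by (metis dim_eq_full linear_subspace_image span_eq_iff subspace_UNIV)
  obtain T where T: "linear T" "T \<circ> S = id"
    using linear_injective_left_inverse[OF S \<open>inj S\<close>] by blast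
  have TS: "T (S v) = v" for v using T(2) by (metis comp_apply id_apply)
  have "S (T y) = y" for y
    using TS \<open>range S = UNIV\<close> by (metis rangeE UNIV_I)
  then show ?thesis
    using that[OF T(1)] TS unfolding S_def by (metis Pair_inject)
qed

text \<open>Extends a single kernel vector at w to a linear choice of kernel vectors at all
  frequencies, so that nearby frequencies have nearby directions.\<close>

lemma characteristic_direction:
  fixes A1 A2 :: "real ^ 'd ^ 'm"
  assumes T: "linear T" "\<forall>p q. A1 *v T (p, q) = p \<and> A2 *v T (p, q) = q"
    "\<forall>v. T (A1 *v v, A2 *v v) = v"
    and v: "principal_symbol A1 A2 w *v v = 0" "w \<noteq> 0"
  obtains J where "linear J" "\<forall>k. principal_symbol A1 A2 k *v J k = 0" "J w = v"
proof -
  define p q where "p = A1 *v v" and "q = A2 *v v"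
  \<comment> \<open>Since \<open>w1 p + w2 q = 0\<close>, the pair (p, q) has the form
    \<open>(- w2 a, w1 a)\<close>; solving for \<open>a\<close> gives this quotient.\<close>
  define a where "a = inverse (w \<bullet> w) *\<^sub>R (w $ 1 *\<^sub>R q - w $ 2 *\<^sub>R p)"
  define J where "J k = T (- (k $ 2) *\<^sub>R a, k $ 1 *\<^sub>R a)" for k :: "real ^ 2"
  have "linear J"
  proof (rule linearI)
    fix x y
    have "J (x + y) = T ((- (x $ 2) *\<^sub>R a, x $ 1 *\<^sub>R a) + (- (y $ 2) *\<^sub>R a, y $ 1 *\<^sub>R a))"
      by (simp add: J_def scaleR_add_left scaleR_diff_left)
    then show "J (x + y) = J x + J y" unfolding J_def using linear_add[OF T(1)] by metis
  next
    fix r x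
    have "J (r *\<^sub>R x) = T (r *\<^sub>R (- (x $ 2) *\<^sub>R a, x $ 1 *\<^sub>R a))"
      by (simp add: J_def)
    then show "J (r *\<^sub>R x) = r *\<^sub>R J x" unfolding J_def using linear_cmul[OF T(1)] by metis
  qed
  moreover have "\<forall>k. principal_symbol A1 A2 k *v J k = 0"
    using T(2) by (simp add: symbol_mult_vec J_def)
  moreover have "J w = v"
  proof -
    have z: "w $ 1 *\<^sub>R p + w $ 2 *\<^sub>R q = 0"
      using v(1) by (simp add: symbol_mult_vec p_def q_def)
    have ww: "w \<bullet> w = w $ 1 * w $ 1 + w $ 2 * w $ 2" "w \<bullet> w \<noteq> 0"
      using v(2) by (simp add: inner_vec_def sum_2) (simp add: v(2))
    have e2: "w $ 2 *\<^sub>R (w $ 1 *\<^sub>R q - w $ 2 *\<^sub>R p) = w $ 1 *\<^sub>R (w $ 1 *\<^sub>R p + w $ 2 *\<^sub>R q) - (w \<bullet> w) *\<^sub>R p"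
      unfolding ww(1) by (simp add: algebra_simps)
    have "- (w $ 2) *\<^sub>R a = - (inverse (w \<bullet> w) *\<^sub>R (w $ 2 *\<^sub>R (w $ 1 *\<^sub>R q - w $ 2 *\<^sub>R p)))"
      by (simp add: a_def mult.commute)
    then have "- (w $ 2) *\<^sub>R a = p"
      unfolding e2 z using ww(2) by simp
    moreover have e1: "w $ 1 *\<^sub>R (w $ 1 *\<^sub>R q - w $ 2 *\<^sub>R p) = (w \<bullet> w) *\<^sub>R q - w $ 2 *\<^sub>R (w $ 1 *\<^sub>R p + w $ 2 *\<^sub>R q)"
      unfolding ww(1) by (simp add: algebra_simps)
    have "w $ 1 *\<^sub>R a = inverse (w \<bullet> w) *\<^sub>R (w $ 1 *\<^sub>R (w $ 1 *\<^sub>R q - w $ 2 *\<^sub>R p))"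
      by (simp add: a_def mult.commute)
    then have "w $ 1 *\<^sub>R a = q"
      unfolding e1 z using ww(2) by simp
    ultimately show ?thesis
      unfolding J_def using T(3) by (simp add: p_def q_def)
  qed
  ultimately show ?thesis by (rule that)
qed

lemma rational_approximation:
  fixes w :: "real ^ 'n"
  obtains k :: "nat \<Rightarrow> real ^ 'n" where "\<forall>n i. k n $ i \<in> \<int>" "(\<lambda>n. inverse (real (Suc n)) *\<^sub>R k n) \<longlonglongrightarrow> w"
proof
  let ?k = "\<lambda>n. (\<chi> i. of_int \<lfloor>real (Suc n) * w $ i\<rfloor>) :: real ^ 'n"
  show "\<forall>n i. ?k n $ i \<in> \<int>" by simp
  show "(\<lambda>n. inverse (real (Suc n)) *\<^sub>R ?k n) \<longlonglongrightarrow> w"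
  proof (rule vec_tendstoI)
    fix i
    have "(\<lambda>n. inverse (real (Suc n)) * of_int \<lfloor>real (Suc n) * w $ i\<rfloor>) \<longlonglongrightarrow> w $ i"
    proof (rule tendsto_sandwich[OF always_eventually always_eventually, OF allI allI])
      show "w $ i - inverse (real (Suc n)) \<le> inverse (real (Suc n)) * of_int \<lfloor>real (Suc n) * w $ i\<rfloor>" for n
      proof -
        have "inverse (real (Suc n)) * (real (Suc n) * w $ i - 1) \<le> inverse (real (Suc n)) * of_int \<lfloor>real (Suc n) * w $ i\<rfloor>"
          by (intro mult_left_mono inverse_nonnegative_iff_nonnegative[THEN iffD2] of_nat_0_le_iff) linarith
        then show ?thesis by (simp add: right_diff_distrib mult.assoc[symmetric] del: of_nat_Suc)
      qed
      show "inverse (real (Suc n)) * of_int \<lfloor>real (Suc n) * w $ i\<rfloor> \<le> w $ i" for n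
      proof -
        have "inverse (real (Suc n)) * of_int \<lfloor>real (Suc n) * w $ i\<rfloor> \<le> inverse (real (Suc n)) * (real (Suc n) * w $ i)"
          by (intro mult_left_mono inverse_nonnegative_iff_nonnegative[THEN iffD2] of_nat_0_le_iff) linarith
        then show ?thesis by (simp add: mult.assoc[symmetric] del: of_nat_Suc)
      qed
      show "(\<lambda>n. w $ i - inverse (real (Suc n))) \<longlonglongrightarrow> w $ i"
        using tendsto_diff[OF tendsto_const LIMSEQ_inverse_real_of_nat] by simp
    qed simp
    then show "(\<lambda>n. (inverse (real (Suc n)) *\<^sub>R ?k n) $ i) \<longlonglongrightarrow> w $ i"
      by simp
  qed
qed

text \<open>The directions \<open>J (k n / (n + 1))\<close> are kernel vectors at the integer
  frequencies \<open>k n\<close> and tend to v, so continuity of F carries the inequality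
  over.\<close>

lemma A_quasiconvex_convex_characteristic:
  fixes A1 A2 :: "real ^ 'd ^ 'm"
  assumes dim: "CARD('d) = 2 * CARD('m)"
    and ker: "{v. A1 *v v = 0} \<inter> {v. A2 *v v = 0} = {0}"
    and F: "continuous_on UNIV F" "A_quasiconvex A1 A2 F"
    and v: "v \<in> characteristic_cone A1 A2" and t: "0 \<le> t" "t \<le> 1"
  shows "F (a + t *\<^sub>R v) \<le> (1 - t) * F a + t * F (a + v)"
proof -
  obtain w where w: "w \<noteq> 0" "principal_symbol A1 A2 w *v v = 0"
    using v by (auto simp: characteristic_cone_def)
  obtain T where T: "linear T" "\<forall>p q. A1 *v T (p, q) = p \<and> A2 *v T (p, q) = q"
    "\<forall>v. T (A1 *v v, A2 *v v) = v"
    by (rule symbol_right_inverse[OF dim ker])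
  obtain J where J: "linear J" "\<forall>k. principal_symbol A1 A2 k *v J k = 0" "J w = v"
    by (rule characteristic_direction[OF T w(2,1)])
  obtain k :: "nat \<Rightarrow> real ^ 2" where k: "\<forall>n i. k n $ i \<in> \<int>"
    "(\<lambda>n. inverse (real (Suc n)) *\<^sub>R k n) \<longlonglongrightarrow> w"
    by (rule rational_approximation)
  let ?v = "\<lambda>n. J (inverse (real (Suc n)) *\<^sub>R k n)"
  have lim: "?v \<longlonglongrightarrow> v"
    using isCont_tendsto_compose[OF linear_continuous_at k(2), of J] J(1,3) by (simp add: linear_linear)
  have le: "F (a + t *\<^sub>R ?v n) \<le> (1 - t) * F a + t * F (a + ?v n)" for n
  proof (cases "k n = 0")
    \<comment> \<open>Rounding may produce the frequency 0, which the integer case excludes; the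
      direction is then 0 as well.\<close>
    case True
    then show ?thesis using linear_0[OF J(1)] by (simp add: algebra_simps)
  next
    case False
    have "principal_symbol A1 A2 (k n) *v ?v n = 0"
      using J(2) by (simp add: linear_cmul[OF J(1)] matrix_vector_mult_scaleR del: of_nat_Suc)
    then show ?thesis
      using A_quasiconvex_convex_integer_direction[OF F _ False] k(1) t by simp
  qed
  have F_lim: "(\<lambda>n. F (g n)) \<longlonglongrightarrow> F l" if "g \<longlonglongrightarrow> l" for g l
    using F(1) that by (metis UNIV_I continuous_on_eq_continuous_at isCont_tendsto_compose open_UNIV)
  show ?thesis
  proof (rule LIMSEQ_le)
    show "(\<lambda>n. F (a + t *\<^sub>R ?v n)) \<longlonglongrightarrow> F (a + t *\<^sub>R v)"
      by (intro F_lim tendsto_intros lim)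
    show "(\<lambda>n. (1 - t) * F a + t * F (a + ?v n)) \<longlonglongrightarrow> (1 - t) * F a + t * F (a + v)"
      by (intro F_lim tendsto_intros lim)
  qed (use le in blast)
qed

text \<open>The positive part of F is an admissible competitor in the definition of the
  hull.\<close>

lemma Lambda_co_subset_sublevel:
  fixes A1 A2 :: "real ^ 'd ^ 'm"
  assumes "CARD('d) = 2 * CARD('m)"
    and "{v. A1 *v v = 0} \<inter> {v. A2 *v v = 0} = {0}"
    and "continuous_on UNIV F" "A_quasiconvex A1 A2 F"
  shows "Lambda_co (characteristic_cone A1 A2) {\<eta>. F \<eta> = 0} \<subseteq> {\<eta>. F \<eta> \<le> 0}"
proof
  define H where "H x = max (F x) 0" for x
  let ?G = "\<lambda>x. ereal (H x)"
  have "Lambda_convex (characteristic_cone A1 A2) ?G"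
    unfolding Lambda_convex_def
  proof (intro conjI allI impI)
    fix t :: real and a b assume *: "0 \<le> t \<and> t \<le> 1 \<and> b - a \<in> characteristic_cone A1 A2"
    have eq: "t *\<^sub>R a + (1 - t) *\<^sub>R b = a + (1 - t) *\<^sub>R (b - a)"
      by (simp add: algebra_simps)
    have "F (a + (1 - t) *\<^sub>R (b - a)) \<le> t * F a + (1 - t) * F b"
      using A_quasiconvex_convex_characteristic[OF assms, of "b - a" "1 - t" a] * by simp
    also have "\<dots> \<le> t * H a + (1 - t) * H b"
      using * by (intro add_mono mult_left_mono) (auto simp: H_def)
    finally have "H (a + (1 - t) *\<^sub>R (b - a)) \<le> t * H a + (1 - t) * H b"
      unfolding H_def[of "a + _"] using * by (intro max.boundedI) (auto simp: H_def)
    then show "?G (t *\<^sub>R a + (1 - t) *\<^sub>R b) \<le> ereal t * ?G a + ereal (1 - t) * ?G b"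
      unfolding eq by (simp only: times_ereal.simps plus_ereal.simps ereal_less_eq)
  qed simp
  moreover fix \<xi> assume "\<xi> \<in> Lambda_co (characteristic_cone A1 A2) {\<eta>. F \<eta> = 0}"
  moreover have "\<forall>\<eta>\<in>{\<eta>. F \<eta> = 0}. ?G \<eta> = 0" by (simp add: H_def)
  ultimately have "?G \<xi> \<le> 0" unfolding Lambda_co_def by blast
  then show "\<xi> \<in> {\<eta>. F \<eta> \<le> 0}" by (simp add: H_def)
qed

section \<open>Construction of the solution\<close>

lemma exists_zero_on_ray:
  fixes F :: "real ^ 'd \<Rightarrow> real"
  assumes F: "continuous_on UNIV F" "filterlim F at_top at_infinity" and "F \<xi> < 0" "v \<noteq> 0"
  shows "\<exists>t>0. F (\<xi> + t *\<^sub>R v) = 0"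
proof -
  have "eventually (\<lambda>x. 0 \<le> F x) at_infinity"
    using F(2) unfolding filterlim_at_top by blast
  then obtain b where b: "\<forall>x. b \<le> norm x \<longrightarrow> 0 \<le> F x"
    unfolding eventually_at_infinity by blast
  \<comment> \<open>At this distance the triangle inequality leaves norm at least
    \<open>\<bar>b\<bar>\<close>, where F is already nonnegative.\<close>
  define t where "t = (\<bar>b\<bar> + norm \<xi>) / norm v"
  have "0 \<le> t" by (simp add: t_def)
  have "norm (t *\<^sub>R v) = \<bar>b\<bar> + norm \<xi>"
    using \<open>0 \<le> t\<close> \<open>v \<noteq> 0\<close> by (simp add: t_def)
  moreover have "norm (t *\<^sub>R v) - norm \<xi> \<le> norm (\<xi> + t *\<^sub>R v)"
    using norm_diff_ineq[of "t *\<^sub>R v" \<xi>] by (simp add: add.commute)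
  ultimately have "b \<le> norm (\<xi> + t *\<^sub>R v)" by linarith
  then have "0 \<le> F (\<xi> + t *\<^sub>R v)" using b by blast
  moreover have "continuous_on {0..t} (\<lambda>s. F (\<xi> + s *\<^sub>R v))"
    by (intro continuous_on_compose2[OF F(1)] continuous_intros) auto
  ultimately obtain s where s: "0 \<le> s" "F (\<xi> + s *\<^sub>R v) = 0"
    using IVT'[of "\<lambda>s. F (\<xi> + s *\<^sub>R v)" 0 0 t] \<open>F \<xi> < 0\<close> \<open>0 \<le> t\<close> by auto
  then have "s \<noteq> 0" using \<open>F \<xi> < 0\<close> by auto
  then show ?thesis using s by (intro exI[of _ s]) simp
qed

text \<open>Applying \<open>A1\<close> and \<open>A2\<close> to \<open>J (g x)\<close> turns the
  pairing into the curl of \<open>g\<close> times \<open>a\<close>; the constant \<xi> contributes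
  only integrals of derivatives of \<phi>, which vanish.\<close>

lemma diff_op_free_weak_grad:
  fixes A1 A2 :: "real ^ 'd ^ 'm"
  assumes J: "\<forall>p. A1 *v J p = - (p $ 2) *\<^sub>R a" "\<forall>p. A2 *v J p = p $ 1 *\<^sub>R a" "continuous_on UNIV J"
    and g: "g \<in> borel_measurable borel" "weak_grad g" "\<And>x. norm (g x) \<le> D"
  shows "diff_op_free A1 A2 (\<lambda>x. \<xi> + J (g x))"
  unfolding diff_op_free_def
proof (intro allI impI)
  fix \<phi> :: "real ^ 2 \<Rightarrow> real" assume "test_function \<phi>"
  then have \<phi>: "C1_compact \<phi>" by (rule test_function_imp_C1_compact)
  obtain R where R: "\<And>i. continuous_on UNIV (partial_deriv i \<phi>)"
    "\<And>i x. R < norm x \<Longrightarrow> partial_deriv i \<phi> x = 0"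
    using C1_compact_partialE[OF \<phi>] by metis
  have [measurable]: "partial_deriv i \<phi> \<in> borel_measurable borel" for i
    using R(1) by (rule borel_measurable_continuous_onI)
  have [measurable]: "(\<lambda>x. g x $ i) \<in> borel_measurable borel" for i
    by (rule borel_measurable_vec_nth[OF g(1)])
  have comp: "\<bar>g x $ i\<bar> \<le> D" for x i
    using component_le_norm_cart[of "g x" i] g(3)[of x] by linarith
  have int: "integrable lborel (partial_deriv i \<phi>)"
    "integrable lborel (\<lambda>x. partial_deriv i \<phi> x * g x $ j)" for i j
  proof -
    obtain B where B: "0 \<le> B" "\<And>x. \<bar>partial_deriv i \<phi> x\<bar> \<le> B"
      using bounded_if_continuous_compact_support[OF R] by blast
    show "integrable lborel (partial_deriv i \<phi>)"
      by (rule integrable_if_bounded_support[OF _ R(2) B(2)]) measurable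
    show "integrable lborel (\<lambda>x. partial_deriv i \<phi> x * g x $ j)"
    proof (rule integrable_if_bounded_support[where R = R and B = "B * D"])
      show "\<bar>partial_deriv i \<phi> x * g x $ j\<bar> \<le> B * D" for x
        unfolding abs_mult using B comp by (intro mult_mono) auto
    qed (use R(2) in simp_all)
  qed
  let ?h = "\<lambda>x. partial_deriv 1 \<phi> x *\<^sub>R (A1 *v \<xi>) + partial_deriv 2 \<phi> x *\<^sub>R (A2 *v \<xi>) +
    (partial_deriv 2 \<phi> x * g x $ 1 - partial_deriv 1 \<phi> x * g x $ 2) *\<^sub>R a"
  have "(\<lambda>x. partial_deriv 1 \<phi> x *\<^sub>R (A1 *v (\<xi> + J (g x))) + partial_deriv 2 \<phi> x *\<^sub>R (A2 *v (\<xi> + J (g x)))) = ?h"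
    using J(1,2) by (auto simp: matrix_vector_right_distrib fun_eq_iff algebra_simps)
  moreover have "(LINT x|lebesgue. ?h x) = (LINT x|lborel. ?h x)"
    by (rule integral_completion) measurable
  moreover have "(LINT x|lborel. ?h x) = 0"
  proof -
    have "(LINT x|lborel. ?h x) =
        (LINT x|lborel. partial_deriv 1 \<phi> x) *\<^sub>R (A1 *v \<xi>) + (LINT x|lborel. partial_deriv 2 \<phi> x) *\<^sub>R (A2 *v \<xi>) +
        ((LINT x|lborel. partial_deriv 2 \<phi> x * g x $ 1) - (LINT x|lborel. partial_deriv 1 \<phi> x * g x $ 2)) *\<^sub>R a"
      using int by simp
    then show ?thesis
      using g(2) \<phi> by (simp add: integral_partial_deriv_eq_0[OF \<phi>] weak_grad_def)
  qed
  ultimately show "distr_diff_op A1 A2 (\<lambda>x. \<xi> + J (g x)) \<phi> = 0"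
    unfolding distr_diff_op_def by simp
qed

theorem theorem3p12:
  fixes A1 A2 :: "real ^ 'd ^ 'm"
    and \<Omega> :: "(real ^ 2) set"
    and F :: "real ^ 'd \<Rightarrow> real"
    and E \<Lambda> :: "(real ^ 'd) set"
    and \<xi> :: "real ^ 'd"
  assumes dim: "CARD('d) = 2 * CARD('m)"
    and rank: "\<And>w :: real ^ 2. w \<noteq> 0 \<Longrightarrow> rank (principal_symbol A1 A2 w) = CARD('m)"
    and ker: "{v. A1 *v v = 0} \<inter> {v. A2 *v v = 0} = {0}"
    and Omega: "bounded \<Omega>" "open \<Omega>"
    and F_cont: "continuous_on UNIV F"
    and F_qc: "A_quasiconvex A1 A2 F"
    and F_coercive: "filterlim F at_top at_infinity"
    and E: "E = {\<eta>. F \<eta> = 0}"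
    and Lambda: "\<Lambda> = characteristic_cone A1 A2"
    and int_nonempty: "interior (Lambda_co \<Lambda> E) \<noteq> {}"
    and xi: "\<xi> \<in> E \<union> interior (Lambda_co \<Lambda> E)"
  shows "\<exists>u :: real ^ 2 \<Rightarrow> real ^ 'd.
    L_infinity u \<and>
    (AE x in lebesgue. x \<in> \<Omega> \<longrightarrow> u x \<in> E) \<and>
    diff_op_free A1 A2 u \<and>
    (\<forall>x. x \<notin> \<Omega> \<longrightarrow> u x = \<xi>)"
proof -
  obtain T where T: "linear T" "\<forall>p q. A1 *v T (p, q) = p \<and> A2 *v T (p, q) = q"
    "\<forall>v. T (A1 *v v, A2 *v v) = v"
    by (rule symbol_right_inverse[OF dim ker])
  \<comment> \<open>Any nonzero vector would do; \<open>undefined\<close> merely picks a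
    coordinate.\<close>
  define a :: "real ^ 'm" where "a = axis undefined 1"
  define J where "J p = T (- (p $ 2) *\<^sub>R a, p $ 1 *\<^sub>R a)" for p :: "real ^ 2"
  have J: "\<forall>p. A1 *v J p = - (p $ 2) *\<^sub>R a" "\<forall>p. A2 *v J p = p $ 1 *\<^sub>R a"
    using T(2) by (simp_all add: J_def)
  have J_cont: "continuous_on UNIV J"
    unfolding J_def by (intro linear_continuous_on_compose[OF _ T(1)] continuous_intros)
  have J_axis: "J (axis i c) = c *\<^sub>R J (axis i 1)" for i c
    unfolding J_def linear_cmul[OF T(1), symmetric] by (simp add: axis_def)
  \<comment> \<open>\<open>A1\<close> and \<open>A2\<close> recover the components of p, up to sign,
    as multiples of the nonzero \<open>a\<close>.\<close>
  have J_nz: "J (axis i 1) \<noteq> 0" for i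
  proof
    assume "J (axis i 1) = 0"
    then have "axis i 1 $ 1 *\<^sub>R a = 0" "axis i (1::real) $ 2 *\<^sub>R a = 0"
      using J by (metis matrix_vector_mult_0_right neg_equal_0_iff_equal scaleR_minus_left)+
    moreover have "a \<noteq> 0" by (simp add: a_def axis_eq_0_iff)
    moreover have "i = 1 \<or> i = 2" using exhaust_2 by blast
    ultimately show False by auto
  qed
  have "F \<xi> \<le> 0"
    using xi Lambda_co_subset_sublevel[OF dim ker F_cont F_qc] interior_subset[of "Lambda_co \<Lambda> E"]
    unfolding E Lambda by auto
  \<comment> \<open>Both cases yield a finite set of offsets. If \<open>F \<xi> = 0\<close>, the
    offset 0 with the zero field suffices.\<close>
  have "\<exists>S. (\<forall>p\<in>S. F (\<xi> + J p) = 0) \<and> finite S \<and> (\<exists>g. solves_inclusion S \<Omega> g)"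
  proof (cases "F \<xi> = 0")
    case True
    have "J 0 = 0" using linear_0[OF T(1)] by (simp add: J_def zero_prod_def)
    moreover have "solves_inclusion {0} \<Omega> (\<lambda>_. 0)"
      by (simp add: solves_inclusion_def weak_grad_def)
    ultimately show ?thesis using True by (intro exI[of _ "{0}"]) auto
  next
    case False
    then have "F \<xi> < 0" using \<open>F \<xi> \<le> 0\<close> by simp
    note ray = exists_zero_on_ray[OF F_cont F_coercive this]
    have "\<forall>i. \<exists>t>0. F (\<xi> + t *\<^sub>R J (axis i 1)) = 0" "\<forall>i. \<exists>t>0. F (\<xi> + t *\<^sub>R - J (axis i 1)) = 0"
      by (intro allI ray; use J_nz in simp)+
    then obtain r s where rs: "\<And>i. 0 < r i" "\<And>i. F (\<xi> + r i *\<^sub>R J (axis i 1)) = 0"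
      "\<And>i. 0 < s i" "\<And>i. F (\<xi> + s i *\<^sub>R - J (axis i 1)) = 0"
      by metis
    let ?S = "slopes (\<chi> i. r i) (\<chi> i. s i)"
    have "\<exists>g. solves_inclusion ?S \<Omega> g"
      using rs by (intro solves_inclusion_open[OF Omega]) simp_all
    moreover have "\<forall>p\<in>?S. F (\<xi> + J p) = 0"
      using rs(2,4) by (auto simp: slopes_def J_axis[of _ "r _"] J_axis[of _ "- s _"])
    moreover have "finite ?S" by (simp add: slopes_def)
    ultimately show ?thesis by blast
  qed
  then obtain S g where S: "\<forall>p\<in>S. F (\<xi> + J p) = 0" "finite S" and "solves_inclusion S \<Omega> g"
    by blast
  then have g: "g \<in> borel_measurable borel" "weak_grad g" "\<And>x. g x \<in> insert 0 S"
    "\<And>x. x \<notin> \<Omega> \<Longrightarrow> g x = 0" "AE x in lborel. x \<in> \<Omega> \<longrightarrow> g x \<in> S"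
    by (simp_all add: solves_inclusion_def)
  \<comment> \<open>The field takes finitely many values, at every point, so any \<open>h\<close> is
    bounded along it.\<close>
  have bounded: "\<exists>D. \<forall>x. norm (h (g x)) \<le> D" for h :: "real ^ 2 \<Rightarrow> 'c::real_normed_vector"
  proof -
    have "bounded (h ` insert 0 S)" using S(2) by (intro finite_imp_bounded) simp
    then show ?thesis using g(3) unfolding bounded_iff by blast
  qed
  let ?u = "\<lambda>x. \<xi> + J (g x)"
  have "L_infinity ?u"
  proof -
    have "?u \<in> borel_measurable lborel"
      using borel_measurable_continuous_on[OF J_cont, of g lborel] g(1) by (simp add: borel_measurable_add)
    then show ?thesis
      using bounded[of "\<lambda>p. \<xi> + J p"] unfolding L_infinity_def by (auto intro: measurable_completion)
  qed
  moreover have "AE x in lebesgue. x \<in> \<Omega> \<longrightarrow> ?u x \<in> E"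
    using AE_completion[OF g(5)] by eventually_elim (use S(1) in \<open>auto simp: E\<close>)
  moreover have "diff_op_free A1 A2 ?u"
    using bounded[of "\<lambda>p. p"] diff_op_free_weak_grad[OF J J_cont g(1,2)] by blast
  moreover have "\<forall>x. x \<notin> \<Omega> \<longrightarrow> ?u x = \<xi>"
    using g(4) linear_0[OF T(1)] by (simp add: J_def zero_prod_def)
  ultimately show ?thesis by (intro exI[of _ ?u]) simp
qed

end
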